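(* Assume $\gamma_k\neq\sqrt{\rho_k/E_k}$ for $k=1,3,\ldots,2m+1$. Consider $$\mathbf h_{\mathcal O}\mathbf p_{\mathcal O}\ddot v_{\mathcal O}-\mathbf h_{\mathcal O}\mathbf E_{\mathcal O}v_{\mathcal O}''=0\ \text{ on }\Omega\times\mathbb R^+,\qquad v_{\mathcal O}(0,t)=0,\quad v_{\mathcal O}'(L,t)+\Upsilon_{\mathcal O}\dot v_{\mathcal O}(L,t)=0,$$ with initial data $v_{\mathcal O}(x,0)=v^0_{\mathcal O}$, $\dot v_{\mathcal O}(x,0)=v^1_{\mathcal O}$. Then the eigenfunctions of this system $$\{(\mathbf e_{k,n},\lambda_{k,n}\mathbf e_{k,n})^{\mathrm T}:\ k=1,3,\ldots,2m+1,\ n\in\mathbb Z\},$$ corresponding to the branches of eigenvalues $\{\lambda_{k,n}:k=1,3,\ldots,2m+1,\ n\in\mathbb Z\}$, form a Riesz basis in $(H^1_*(\Omega))^{m+1}\times(L^2(\Omega))^{m+1}$, where $\mathbf e_{k,n}=(0,\ldots,e_{k,n},\ldots,0)^{\mathrm T}$ (with $e_{k,n}$ in the component belonging to layer $k$), $e_{k,n}(x)=\theta_{k,n}^{-1}\sin(\theta_{k,n}x)$, $\lambda_{k,n}=i\sqrt{E_k/\rho_k}\,\theta_{k,n}$ for all $n\in\mathbb Z$, and $$\theta_{k,n}=\begin{cases}\dfrac{i}{2L}\ln\left|\dfrac{\gamma_k\sqrt{E_k/\rho_k}+1}{\gamma_k\sqrt{E_k/\rho_k}-1}\right|+\dfrac{n\pi}{L},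 & \gamma_k>\sqrt{\rho_k/E_k},\\[3mm] \dfrac{i}{2L}\ln\left|\dfrac{\gamma_k\sqrt{E_k/\rho_k}+1}{\gamma_k\sqrt{E_k/\rho_k}-1}\right|+\dfrac{(n+\frac12)\pi}{L}, & \gamma_k<\sqrt{\rho_k/E_k}.\end{cases}$$
   Context: $m\ge1$ is an integer, $L>0$, $\Omega=(0,L)$; $h_k,\rho_k,E_k,\gamma_k>0$ for $k=1,3,\ldots,2m+1$ are constants; $\mathbf h_{\mathcal O}=\mathrm{diag}(h_1,h_3,\ldots,h_{2m+1})$, $\mathbf p_{\mathcal O}=\mathrm{diag}(\rho_1,\rho_3,\ldots,\rho_{2m+1})$, $\mathbf E_{\mathcal O}=\mathrm{diag}(E_1,E_3,\ldots,E_{2m+1})$, $\Upsilon_{\mathcal O}=\mathrm{diag}(\gamma_1,\gamma_3,\ldots,\gamma_{2m+1})$; $v_{\mathcal O}=(v^1,v^3,\ldots,v^{2m+1})^{\mathrm T}$ is the unknown, so the component of layer $k$ is number $(k+1)/2$. $H^1_*(\Omega)=\{u\in H^1(\Omega):u(0)=0\}$ (complex-valued). Eigenvalues/eigenfunctions of the system are those of $(\mathbf u,\mathbf v)\mapsto(\mathbf v,\mathbf p_{\mathcal O}^{-1}\mathbf E_{\mathcal O}\mathbf u'')$ on $(H^1_*(\Omega))^{m+1}\times(L^2(\Omega))^{m+1}$ with domain $\{(\mathbf u,\mathbf v):\mathbf u\in(H^2(\Omega)\cap H^1_*(\Omega))^{m+1},\ \mathbf v\in(H^1_*(\Omega))^{m+1},\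 \mathbf u'(L)+\Upsilon_{\mathcal O}\mathbf v(L)=0\}$. *)

theory Defs
  imports "HOL-Analysis.Analysis" "HOL-Library.Function_Algebras"
begin

text \<open>
  Elements of \<open>L\<^sup>2\<close> and \<open>H\<^sup>1\<close> over \<open>\<Omega> = (0, L)\<close> are represented by functions on the real line,
  of which only the values on \<open>\<Omega>\<close> (on its closure, for \<open>H\<^sup>1\<close>) matter; \<open>L\<^sup>2\<close>-functions that agree
  almost everywhere on \<open>\<Omega>\<close> stand for the same element.
\<close>

definition L2 :: "real \<Rightarrow> (real \<Rightarrow> complex) set" where
  "L2 L = {f. f \<in> borel_measurable (lebesgue_on {0<..<L}) \<and>
              integrable (lebesgue_on {0<..<L}) (\<lambda>x. (cmod (f x))\<^sup>2)}"

definition L2_inner :: "real \<Rightarrow> (real \<Rightarrow> complex) \<Rightarrow> (real \<Rightarrow> complex) \<Rightarrow> complex" where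
  "L2_inner L f g = (LINT x|lebesgue_on {0<..<L}. f x * cnj (g x))"

text \<open>\<open>\<phi> \<in> C\<^sup>1\<^sub>c(\<Omega>)\<close> with derivative \<open>\<phi>'\<close>.\<close>

definition test_function :: "real \<Rightarrow> (real \<Rightarrow> complex) \<Rightarrow> (real \<Rightarrow> complex) \<Rightarrow> bool" where
  "test_function L \<phi> \<phi>' \<longleftrightarrow>
     (\<forall>x. (\<phi> has_vector_derivative \<phi>' x) (at x)) \<and> continuous_on UNIV \<phi>' \<and>
     (\<exists>a b. 0 < a \<and> b < L \<and> (\<forall>x. x \<notin> {a..b} \<longrightarrow> \<phi> x = 0))"

text \<open>Weak derivatives within \<open>L\<^sup>2\<close>; testing with \<open>C\<^sup>1\<^sub>c\<close> as in Brezis' textbook.\<close>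

definition has_weak_derivative :: "real \<Rightarrow> (real \<Rightarrow> complex) \<Rightarrow> (real \<Rightarrow> complex) \<Rightarrow> bool" where
  "has_weak_derivative L u g \<longleftrightarrow> u \<in> L2 L \<and> g \<in> L2 L \<and>
     (\<forall>\<phi> \<phi>'. test_function L \<phi> \<phi>' \<longrightarrow>
        (LINT x|lebesgue_on {0<..<L}. u x * \<phi>' x) =
        - (LINT x|lebesgue_on {0<..<L}. g x * \<phi> x))"

text \<open>
  The weak derivative, unique up to null sets. If it has a representative that is continuous on
  \<open>[0, L]\<close> then such a representative is chosen, so that the trace \<open>u'(L)\<close> of \<open>u \<in> H\<^sup>2(\<Omega>)\<close> is
  \<open>wderiv L u L\<close>.
\<close>

definition wderiv :: "real \<Rightarrow> (real \<Rightarrow> complex) \<Rightarrow> real \<Rightarrow> complex" where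
  "wderiv L u = (SOME g. has_weak_derivative L u g \<and>
     ((\<exists>w. has_weak_derivative L u w \<and> continuous_on {0..L} w) \<longrightarrow> continuous_on {0..L} g))"

text \<open>\<open>H\<^sup>1\<close>-functions are given by their continuous representatives, which have traces at \<open>0\<close> and \<open>L\<close>.\<close>

definition H1 :: "real \<Rightarrow> (real \<Rightarrow> complex) set" where
  "H1 L = {u. continuous_on {0..L} u \<and> (\<exists>g. has_weak_derivative L u g)}"

definition H1_inner :: "real \<Rightarrow> (real \<Rightarrow> complex) \<Rightarrow> (real \<Rightarrow> complex) \<Rightarrow> complex" where
  "H1_inner L u w = L2_inner L u w + L2_inner L (wderiv L u) (wderiv L w)"

definition H1_star :: "real \<Rightarrow> (real \<Rightarrow> complex) set" where
  "H1_star L = {u \<in> H1 L. u 0 = 0}"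

definition H2 :: "real \<Rightarrow> (real \<Rightarrow> complex) set" where
  "H2 L = {u \<in> H1 L. wderiv L u \<in> H1 L}"


text \<open>
  Riesz bases, for a space \<open>V\<close> with scalar multiplication \<open>sc\<close> and inner product \<open>ip\<close>, in the form of
  the definition in Curtain and Zwart's textbook: the linear span is dense, and the norm of a finite
  linear combination is equivalent to the \<open>\<ell>\<^sup>2\<close>-norm of its coefficients. The inner product may be
  degenerate, the Hilbert space then being the quotient of \<open>V\<close> by the vectors of norm zero.
\<close>

definition ip_norm :: "('a \<Rightarrow> 'a \<Rightarrow> complex) \<Rightarrow> 'a \<Rightarrow> real" where
  "ip_norm ip z = sqrt (Re (ip z z))"

definition riesz_basis ::
  "(complex \<Rightarrow> 'a::ab_group_add \<Rightarrow> 'a) \<Rightarrow> ('a \<Rightarrow> 'a \<Rightarrow> complex) \<Rightarrow> 'a set \<Rightarrow> 'i set \<Rightarrow> ('i \<Rightarrow> 'a) \<Rightarrow> bool"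
where
  "riesz_basis sc ip V I b \<longleftrightarrow>
     (\<forall>i\<in>I. b i \<in> V) \<and>
     (\<forall>z\<in>V. \<forall>\<epsilon>>0. \<exists>F c. finite F \<and> F \<subseteq> I \<and>
        ip_norm ip (z - (\<Sum>i\<in>F. sc (c i) (b i))) < \<epsilon>) \<and>
     (\<exists>A B. 0 < A \<and> 0 < B \<and>
        (\<forall>F c. finite F \<and> F \<subseteq> I \<longrightarrow>
           A * (\<Sum>i\<in>F. (cmod (c i))\<^sup>2) \<le> (ip_norm ip (\<Sum>i\<in>F. sc (c i) (b i)))\<^sup>2 \<and>
           (ip_norm ip (\<Sum>i\<in>F. sc (c i) (b i)))\<^sup>2 \<le> B * (\<Sum>i\<in>F. (cmod (c i))\<^sup>2)))"


text \<open>
  Vectors with \<open>m + 1\<close> components are indexed by the layer numbers \<open>1, 3, \<dots>, 2m + 1\<close> themselves; the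
  diagonal matrices act componentwise. Values at other indices are irrelevant.
\<close>

definition odd_layers :: "nat \<Rightarrow> nat set" where
  "odd_layers m = {k. odd k \<and> k \<le> 2 * m + 1}"

type_synonym field_vec = "nat \<Rightarrow> real \<Rightarrow> complex"

type_synonym state = "field_vec \<times> field_vec"

definition state_scale :: "complex \<Rightarrow> state \<Rightarrow> state" where
  "state_scale c z = ((\<lambda>k x. c * fst z k x), (\<lambda>k x. c * snd z k x))"

definition state_space :: "nat \<Rightarrow> real \<Rightarrow> state set" where
  "state_space m L = {(u, v). \<forall>k\<in>odd_layers m. u k \<in> H1_star L \<and> v k \<in> L2 L}"

definition state_inner :: "nat \<Rightarrow> real \<Rightarrow> state \<Rightarrow> state \<Rightarrow> complex" where
  "state_inner m L z w =
     (\<Sum>k\<in>odd_layers m. H1_inner L (fst z k) (fst w k) + L2_inner L (snd z k) (snd w k))"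

definition state_eq :: "nat \<Rightarrow> real \<Rightarrow> state \<Rightarrow> state \<Rightarrow> bool" where
  "state_eq m L z w \<longleftrightarrow> (\<forall>k\<in>odd_layers m.
     AE x in lebesgue_on {0<..<L}. fst z k x = fst w k x \<and> snd z k x = snd w k x)"


definition system_domain :: "nat \<Rightarrow> real \<Rightarrow> (nat \<Rightarrow> real) \<Rightarrow> state set" where
  "system_domain m L \<gamma> = {(u, v). \<forall>k\<in>odd_layers m.
     u k \<in> H2 L \<inter> H1_star L \<and> v k \<in> H1_star L \<and>
     wderiv L (u k) L + of_real (\<gamma> k) * v k L = 0}"

definition system_op :: "real \<Rightarrow> (nat \<Rightarrow> real) \<Rightarrow> (nat \<Rightarrow> real) \<Rightarrow> state \<Rightarrow> state" where
  "system_op L \<rho> E z =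
     (snd z, (\<lambda>k x. of_real (E k / \<rho> k) * wderiv L (wderiv L (fst z k)) x))"

definition system_eigenfunction ::
  "nat \<Rightarrow> real \<Rightarrow> (nat \<Rightarrow> real) \<Rightarrow> (nat \<Rightarrow> real) \<Rightarrow> (nat \<Rightarrow> real) \<Rightarrow> complex \<Rightarrow> state \<Rightarrow> bool"
where
  "system_eigenfunction m L \<rho> E \<gamma> l z \<longleftrightarrow>
     z \<in> system_domain m L \<gamma> \<and> \<not> state_eq m L z 0 \<and>
     state_eq m L (system_op L \<rho> E z) (state_scale l z)"

definition system_eigenvalue ::
  "nat \<Rightarrow> real \<Rightarrow> (nat \<Rightarrow> real) \<Rightarrow> (nat \<Rightarrow> real) \<Rightarrow> (nat \<Rightarrow> real) \<Rightarrow> complex \<Rightarrow> bool"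
where
  "system_eigenvalue m L \<rho> E \<gamma> l \<longleftrightarrow> (\<exists>z. system_eigenfunction m L \<rho> E \<gamma> l z)"


definition theta ::
  "real \<Rightarrow> (nat \<Rightarrow> real) \<Rightarrow> (nat \<Rightarrow> real) \<Rightarrow> (nat \<Rightarrow> real) \<Rightarrow> nat \<Rightarrow> int \<Rightarrow> complex"
where
  "theta L \<rho> E \<gamma> k n =
     \<i> / (2 * of_real L) *
       of_real (ln \<bar>(\<gamma> k * sqrt (E k / \<rho> k) + 1) / (\<gamma> k * sqrt (E k / \<rho> k) - 1)\<bar>) +
     (if \<gamma> k > sqrt (\<rho> k / E k) then of_real (of_int n * pi / L)
      else of_real ((of_int n + 1 / 2) * pi / L))"

definition lam ::
  "real \<Rightarrow> (nat \<Rightarrow> real) \<Rightarrow> (nat \<Rightarrow> real) \<Rightarrow> (nat \<Rightarrow> real) \<Rightarrow> nat \<Rightarrow> int \<Rightarrow> complex"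
where
  "lam L \<rho> E \<gamma> k n = \<i> * of_real (sqrt (E k / \<rho> k)) * theta L \<rho> E \<gamma> k n"

definition e_vec ::
  "real \<Rightarrow> (nat \<Rightarrow> real) \<Rightarrow> (nat \<Rightarrow> real) \<Rightarrow> (nat \<Rightarrow> real) \<Rightarrow> nat \<Rightarrow> int \<Rightarrow> field_vec"
where
  "e_vec L \<rho> E \<gamma> k n = (\<lambda>j x. if j = k
     then inverse (theta L \<rho> E \<gamma> k n) * sin (theta L \<rho> E \<gamma> k n * of_real x) else 0)"

definition eigenstate ::
  "real \<Rightarrow> (nat \<Rightarrow> real) \<Rightarrow> (nat \<Rightarrow> real) \<Rightarrow> (nat \<Rightarrow> real) \<Rightarrow> nat \<Rightarrow> int \<Rightarrow> state"
where
  "eigenstate L \<rho> E \<gamma> k n =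
     (e_vec L \<rho> E \<gamma> k n, (\<lambda>j x. lam L \<rho> E \<gamma> k n * e_vec L \<rho> E \<gamma> k n j x))"

end

theory Submission imports Defs begin

text \<open>
  The layers do not interact, so everything reduces to a single string of length \<open>L\<close> with wave
  speed \<open>c = sqrt (E / \<rho>)\<close>, fixed at \<open>0\<close> and with the condition \<open>u'(L) + \<gamma> v(L) = 0\<close> at the other end.
  Put \<open>a = \<gamma> c\<close>.

  \<^emph>\<open>Eigenvalues.\<close> An eigenfunction \<open>(u, v)\<close> for \<open>l\<close> satisfies \<open>v = l u\<close> and \<open>u'' = \<mu>\<^sup>2 u\<close> weakly, where
  \<open>\<mu> = l / c\<close>. Since \<open>u' \<plusminus> \<mu> u\<close> solves a first order equation, it equals \<open>u'(0) exp (\<plusminus> \<mu> x)\<close>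
  (\<open>second_order_ode\<close>), and the condition at \<open>L\<close> becomes \<open>exp (2 \<mu> L) = (a - 1) / (a + 1)\<close>. Its
  solutions are \<open>\<mu> = \<i> \<theta>\<^sub>n\<close> with the numbers \<open>\<theta>\<^sub>n\<close> of the theorem; here \<open>a \<noteq> 1\<close> is essential, and the
  sign of \<open>a - 1\<close> decides between the two cases for \<open>\<theta>\<^sub>n\<close>. Hence \<open>u\<close> is a multiple of
  \<open>sin (\<theta>\<^sub>n x) / \<theta>\<^sub>n\<close> (\<open>eigenfunction_classification\<close>).

  \<^emph>\<open>Riesz basis.\<close> By the Poincare inequality the norm of \<open>(u, v)\<close> is equivalent to the \<open>L\<^sup>2\<close>-norm of
  \<open>(u', v)\<close>, and the eigenfunctions become \<open>(cos (\<theta>\<^sub>n x), \<i> c sin (\<theta>\<^sub>n x))\<close>. A pair \<open>(f, g)\<close> on \<open>(0, L)\<close> is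
  the same as the single function \<open>W\<close> on \<open>(-L, L)\<close> that is \<open>f + \<i> g\<close> on the right and the reflection of
  \<open>f - \<i> g\<close> on the left, and this turns \<open>(cos (\<theta>\<^sub>n x), sin (\<theta>\<^sub>n x))\<close> into \<open>exp (\<i> \<theta>\<^sub>n x)\<close>. The imaginary
  part \<open>\<tau>\<close> of \<open>\<theta>\<^sub>n\<close> does not depend on \<open>n\<close>, and the real parts are equally spaced with step \<open>\<pi> / L\<close>, so
  \<open>exp (\<i> \<theta>\<^sub>n x)\<close> is the orthogonal system \<open>exp (\<i> n \<pi> x / L)\<close> of \<open>L\<^sup>2(-L, L)\<close> times one function whose modulus
  \<open>exp (- \<tau> x)\<close> is bounded above and below. The norm equivalence (\<open>freq_sums_Riesz\<close>) is then
  Parseval's identity for finite sums, and the density of the span (\<open>freq_sums_dense\<close>) is the density of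
  trigonometric polynomials.

  \<^emph>\<open>Foundations.\<close> Both parts need that a weak derivative determines the increments of a continuous
  function (\<open>weak_derivative_increment\<close>). Uniqueness of weak derivatives, the Poincare inequality and
  the passage from weak to classical solutions all come from this. Density in \<open>L\<^sup>2\<close> is obtained from the approximation
  of measurable functions by continuous ones and from the Stone-Weierstrass theorem on the circle.
\<close>

section \<open>Square-integrable functions on an interval\<close>

abbreviation Om :: "real \<Rightarrow> real measure" where
  "Om L \<equiv> lebesgue_on {0<..<L}"

lemma integrable_Om_continuous:
  fixes f :: "real \<Rightarrow> 'b::euclidean_space"
  assumes "continuous_on {0..L} f"
  shows "integrable (Om L) f"
proof (rule absolutely_integrable_imp_integrable)
  show "f absolutely_integrable_on {0<..<L}"
    using absolutely_integrable_continuous_real[OF assms]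
    by (rule set_integrable_subset) auto
qed auto

lemma integral_Om_derivative:
  fixes F f :: "real \<Rightarrow> 'b::euclidean_space"
  assumes "0 \<le> L" and d: "\<And>x. (F has_vector_derivative f x) (at x)" and "continuous_on {0..L} f"
  shows "integral\<^sup>L (Om L) f = F L - F 0"
proof -
  have "integral\<^sup>L (Om L) f = integral {0<..<L} f"
    by (rule lebesgue_integral_eq_integral[OF integrable_Om_continuous[OF assms(3)]]) auto
  also have "\<dots> = integral {0..L} f"
    by (simp add: integral_open_interval_real)
  also have "(f has_integral (F L - F 0)) {0..L}"
    using d by (intro fundamental_theorem_of_calculus assms(1)) (auto intro: has_vector_derivative_at_within)
  then have "integral {0..L} f = F L - F 0" by (rule integral_unique)
  finally show ?thesis .
qed

lemma finite_measure_Om: "finite_measure (Om L)"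
  by (rule finite_measure_lebesgue_on) auto

lemma measure_Om: "0 \<le> L \<Longrightarrow> measure (Om L) {0<..<L} = L"
  by (subst measure_restrict_space) auto

lemma integral_Om_const: "0 \<le> L \<Longrightarrow> (LINT x|Om L. c) = L * (c::real)"
  by (simp add: measure_Om)

lemma integrable_Om_const: "integrable (Om L) (\<lambda>x. c::'b::{banach,second_countable_topology})"
  using finite_measure.integrable_const[OF finite_measure_Om] .

lemma measurable_Om_continuous:
  fixes f :: "real \<Rightarrow> 'b::euclidean_space"
  shows "continuous_on {0..L} f \<Longrightarrow> f \<in> borel_measurable (Om L)"
  using integrable_Om_continuous by (rule borel_measurable_integrable)

lemma cmod_add_squared_le: "(cmod (a + b))\<^sup>2 \<le> 2 * (cmod a)\<^sup>2 + 2 * (cmod b)\<^sup>2"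
proof -
  have "(cmod (a + b))\<^sup>2 \<le> (cmod a + cmod b)\<^sup>2"
    by (simp add: norm_triangle_ineq power_mono)
  also have "\<dots> \<le> 2 * (cmod a)\<^sup>2 + 2 * (cmod b)\<^sup>2"
    using sum_squares_bound[of "cmod a" "cmod b"] by (simp add: power2_sum)
  finally show ?thesis .
qed

lemma L2_measurable: "f \<in> L2 L \<Longrightarrow> f \<in> borel_measurable (Om L)"
  and L2_square_integrable: "f \<in> L2 L \<Longrightarrow> integrable (Om L) (\<lambda>x. (cmod (f x))\<^sup>2)"
  by (auto simp: L2_def)

lemma L2_continuous: "continuous_on {0..L} f \<Longrightarrow> f \<in> L2 L"
  unfolding L2_def
  by (auto intro!: measurable_Om_continuous integrable_Om_continuous continuous_intros)

lemma L2_add: assumes "f \<in> L2 L" "g \<in> L2 L" shows "(\<lambda>x. f x + g x) \<in> L2 L"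
proof -
  note [measurable] = assms[THEN L2_measurable]
  have "integrable (Om L) (\<lambda>x. (cmod (f x + g x))\<^sup>2)"
  proof (rule Bochner_Integration.integrable_bound)
    show "integrable (Om L) (\<lambda>x. 2 * (cmod (f x))\<^sup>2 + 2 * (cmod (g x))\<^sup>2)"
      using assms by (intro Bochner_Integration.integrable_add integrable_mult_right L2_square_integrable)
  qed (auto simp: cmod_add_squared_le)
  then show ?thesis by (simp add: L2_def)
qed

lemma L2_scale: assumes "f \<in> L2 L" shows "(\<lambda>x. c * f x) \<in> L2 L"
  using assms by (auto simp: L2_def norm_mult power_mult_distrib)

lemma L2_diff: assumes "f \<in> L2 L" "g \<in> L2 L" shows "(\<lambda>x. f x - g x) \<in> L2 L"
  using L2_add[OF assms(1) L2_scale[OF assms(2), of "-1"]] by simp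

lemma L2_cong_AE:
  assumes "f \<in> L2 L" "g \<in> borel_measurable (Om L)" "AE x in Om L. f x = g x"
  shows "g \<in> L2 L"
proof -
  have "integrable (Om L) (\<lambda>x. (cmod (g x))\<^sup>2) = integrable (Om L) (\<lambda>x. (cmod (f x))\<^sup>2)"
    using assms(3) by (intro integrable_cong_AE) (use assms L2_measurable in auto)
  then show ?thesis using assms by (simp add: L2_def)
qed

lemma L2_integrable: assumes "f \<in> L2 L" shows "integrable (Om L) f"
proof (rule Bochner_Integration.integrable_bound)
  show "integrable (Om L) (\<lambda>x. 1 + (cmod (f x))\<^sup>2)"
    using assms by (intro Bochner_Integration.integrable_add integrable_Om_const L2_square_integrable)
  have "cmod z \<le> 1 + (cmod z)\<^sup>2" for z
    using sum_squares_bound[of 1 "cmod z"] norm_ge_zero[of z] unfolding power_one mult_1_right by linarith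
  then show "AE x in Om L. norm (f x) \<le> norm (1 + (cmod (f x))\<^sup>2)"
    by auto
qed (use assms in \<open>rule L2_measurable\<close>)

lemma integrable_mult_continuous:
  assumes "integrable (Om L) f" "continuous_on {0..L} (\<phi>::real \<Rightarrow> complex)"
  shows "integrable (Om L) (\<lambda>x. f x * \<phi> x)"
proof -
  obtain B where B: "\<And>x. x \<in> {0..L} \<Longrightarrow> cmod (\<phi> x) \<le> B"
    using compact_continuous_image[OF assms(2)] compact_imp_bounded bounded_iff by (metis compact_Icc imageI)
  show ?thesis
  proof (rule Bochner_Integration.integrable_bound)
    show "integrable (Om L) (\<lambda>x. B * cmod (f x))"
      using assms by auto
    show "AE x in Om L. norm (f x * \<phi> x) \<le> norm (B * cmod (f x))"
    proof (rule AE_I2)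
      fix x assume "x \<in> space (Om L)"
      then have "cmod (\<phi> x) \<le> B" using B by auto
      then have "cmod (f x) * cmod (\<phi> x) \<le> cmod (f x) * \<bar>B\<bar>"
        by (intro mult_left_mono) auto
      then show "norm (f x * \<phi> x) \<le> norm (B * cmod (f x))"
        by (simp add: norm_mult abs_mult mult.commute)
    qed
    show "(\<lambda>x. f x * \<phi> x) \<in> borel_measurable (Om L)"
      using assms(1) measurable_Om_continuous[OF assms(2)] by measurable
  qed
qed

definition L2_sq :: "real \<Rightarrow> (real \<Rightarrow> complex) \<Rightarrow> real" where
  "L2_sq L f = (LINT x|Om L. (cmod (f x))\<^sup>2)"

lemma L2_inner_self: "L2_inner L f f = of_real (L2_sq L f)"
  unfolding L2_inner_def L2_sq_def
  by (simp add: complex_norm_square[symmetric] del: of_real_power)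

lemma L2_sq_nonneg: "0 \<le> L2_sq L f"
  by (simp add: L2_sq_def)

lemma L2_sq_scale: "L2_sq L (\<lambda>x. z * f x) = (cmod z)\<^sup>2 * L2_sq L f"
  unfolding L2_sq_def by (simp add: norm_mult power_mult_distrib)

lemma L2_sq_cong_AE:
  assumes "f \<in> borel_measurable (Om L)" "g \<in> borel_measurable (Om L)" "AE x in Om L. f x = g x"
  shows "L2_sq L f = L2_sq L g"
  unfolding L2_sq_def using assms by (intro integral_cong_AE) auto

lemma L2_sq_bounded:
  assumes "0 \<le> L" "f \<in> L2 L" "\<And>x. x \<in> {0<..<L} \<Longrightarrow> cmod (f x) \<le> B"
  shows "L2_sq L f \<le> L * B\<^sup>2"
proof -
  have "L2_sq L f \<le> (LINT x|Om L. B\<^sup>2)"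
    unfolding L2_sq_def using assms
    by (intro integral_mono L2_square_integrable integrable_Om_const) (auto intro: power_mono)
  also have "\<dots> = L * B\<^sup>2" by (rule integral_Om_const[OF assms(1)])
  finally show ?thesis .
qed

lemma L2_sq_add_le:
  assumes "f \<in> L2 L" "g \<in> L2 L"
  shows "L2_sq L (\<lambda>x. f x + g x) \<le> 2 * L2_sq L f + 2 * L2_sq L g"
proof -
  have "L2_sq L (\<lambda>x. f x + g x) \<le> (LINT x|Om L. 2 * (cmod (f x))\<^sup>2 + 2 * (cmod (g x))\<^sup>2)"
    unfolding L2_sq_def using assms L2_add[OF assms]
    by (intro integral_mono Bochner_Integration.integrable_add integrable_mult_right L2_square_integrable)
       (auto simp: cmod_add_squared_le)
  also have "\<dots> = 2 * L2_sq L f + 2 * L2_sq L g"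
    unfolding L2_sq_def using assms by (simp add: L2_square_integrable)
  finally show ?thesis .
qed

text \<open>
  The Cauchy-Schwarz inequality against the constant \<open>1\<close>, read off from the nonnegativity of the integral of
  \<open>(L \<bar>f\<bar> - I)\<^sup>2\<close>, where \<open>I\<close> is the integral of \<open>\<bar>f\<bar>\<close>.
\<close>

lemma integral_norm_squared_le:
  assumes "0 < L" "f \<in> L2 L"
  shows "(LINT x|Om L. cmod (f x))\<^sup>2 \<le> L * L2_sq L f"
proof -
  define I where "I = (LINT x|Om L. cmod (f x))"
  have i1: "integrable (Om L) (\<lambda>x. cmod (f x))" using L2_integrable[OF assms(2)] by auto
  note i2 = L2_square_integrable[OF assms(2)]
  have "0 \<le> (LINT x|Om L. (L * cmod (f x) - I)\<^sup>2)" by simp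
  also have "(\<lambda>x. (L * cmod (f x) - I)\<^sup>2)
      = (\<lambda>x. L\<^sup>2 * (cmod (f x))\<^sup>2 - (2 * L * I) * cmod (f x) + I\<^sup>2)"
    by (auto simp: power2_diff power_mult_distrib)
  also have "(LINT x|Om L. L\<^sup>2 * (cmod (f x))\<^sup>2 - (2 * L * I) * cmod (f x) + I\<^sup>2)
      = L\<^sup>2 * L2_sq L f - (2 * L * I) * I + L * I\<^sup>2"
    using i1 i2 integral_Om_const[of L "I\<^sup>2"] assms(1) integrable_Om_const[of L "I\<^sup>2"]
    by (simp add: I_def L2_sq_def)
  finally have "0 \<le> L * (L * L2_sq L f - I\<^sup>2)"
    by (simp add: algebra_simps power2_eq_square)
  then show ?thesis using assms(1) by (simp add: I_def zero_le_mult_iff)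
qed

section \<open>Weak derivatives\<close>

lemma test_function_continuous:
  assumes "test_function L \<phi> \<phi>'" shows "continuous_on S \<phi>" "continuous_on S \<phi>'"
proof -
  show "continuous_on S \<phi>"
    using assms unfolding test_function_def
    by (meson continuous_at_imp_continuous_on has_vector_derivative_continuous)
  show "continuous_on S \<phi>'"
    using assms unfolding test_function_def by (meson continuous_on_subset subset_UNIV)
qed

lemma weak_derivative_add:
  assumes "has_weak_derivative L u g" "has_weak_derivative L v h"
  shows "has_weak_derivative L (\<lambda>x. u x + v x) (\<lambda>x. g x + h x)"
proof -
  have m: "u \<in> L2 L" "g \<in> L2 L" "v \<in> L2 L" "h \<in> L2 L"
    using assms by (auto simp: has_weak_derivative_def)
  note i = m[THEN L2_integrable]
  { fix \<phi> \<phi>' assume t: "test_function L \<phi> \<phi>'"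
    note c = test_function_continuous[OF t]
    have "(LINT x|Om L. (u x + v x) * \<phi>' x) = (LINT x|Om L. u x * \<phi>' x) + (LINT x|Om L. v x * \<phi>' x)"
      unfolding distrib_right by (intro Bochner_Integration.integral_add integrable_mult_continuous i c)
    moreover have "(LINT x|Om L. (g x + h x) * \<phi> x) = (LINT x|Om L. g x * \<phi> x) + (LINT x|Om L. h x * \<phi> x)"
      unfolding distrib_right by (intro Bochner_Integration.integral_add integrable_mult_continuous i c)
    ultimately have "(LINT x|Om L. (u x + v x) * \<phi>' x) = - (LINT x|Om L. (g x + h x) * \<phi> x)"
      using assms t by (simp add: has_weak_derivative_def) }
  then show ?thesis using m by (simp add: has_weak_derivative_def L2_add)
qed

lemma weak_derivative_scale:
  assumes "has_weak_derivative L u g"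
  shows "has_weak_derivative L (\<lambda>x. c * u x) (\<lambda>x. c * g x)"
  using assms by (auto simp: has_weak_derivative_def L2_scale mult.assoc)

lemma weak_derivative_sum:
  assumes "finite F" "\<And>i. i \<in> F \<Longrightarrow> has_weak_derivative L (u i) (g i)"
  shows "has_weak_derivative L (\<lambda>x. \<Sum>i\<in>F. u i x) (\<lambda>x. \<Sum>i\<in>F. g i x)"
  using assms
proof (induction F)
  case empty
  then show ?case by (simp add: has_weak_derivative_def L2_continuous)
next
  case (insert i F)
  then show ?case by (simp add: weak_derivative_add)
qed

lemma weak_derivative_cong_AE:
  assumes "has_weak_derivative L u g" "h \<in> borel_measurable (Om L)" "AE x in Om L. g x = h x"
  shows "has_weak_derivative L u h"
proof -
  have g: "g \<in> L2 L" using assms by (auto simp: has_weak_derivative_def)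
  have "(LINT x|Om L. g x * \<phi> x) = (LINT x|Om L. h x * \<phi> x)" if t: "test_function L \<phi> \<phi>'" for \<phi> \<phi>'
  proof (rule integral_cong_AE)
    have [measurable]: "\<phi> \<in> borel_measurable (Om L)"
      by (rule measurable_Om_continuous[OF test_function_continuous(1)[OF t]])
    note [measurable] = L2_measurable[OF g] assms(2)
    show "(\<lambda>x. g x * \<phi> x) \<in> borel_measurable (Om L)" by measurable
    show "(\<lambda>x. h x * \<phi> x) \<in> borel_measurable (Om L)" by measurable
  qed (use assms(3) in auto)
  then show ?thesis using assms L2_cong_AE[OF g assms(2,3)] by (auto simp: has_weak_derivative_def)
qed

lemma weak_derivative_cong:
  assumes "has_weak_derivative L u g" "\<And>x. x \<in> {0<..<L} \<Longrightarrow> u x = v x"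
  shows "has_weak_derivative L v g"
proof -
  have u: "u \<in> L2 L" using assms by (auto simp: has_weak_derivative_def)
  have "v \<in> L2 L"
  proof (rule L2_cong_AE[OF u])
    show "v \<in> borel_measurable (Om L)"
      using L2_measurable[OF u] by (rule measurable_cong[THEN iffD1, rotated]) (use assms(2) in auto)
  qed (use assms(2) in auto)
  moreover have "(LINT x|Om L. u x * \<phi>' x) = (LINT x|Om L. v x * \<phi>' x)" for \<phi>'
    by (rule Bochner_Integration.integral_cong) (use assms(2) in auto)
  ultimately show ?thesis using assms(1) by (simp add: has_weak_derivative_def)
qed

lemma weak_derivative_classical:
  assumes "0 < L" and d: "\<And>x. (u has_vector_derivative g x) (at x)" and c: "continuous_on UNIV g"
  shows "has_weak_derivative L u g"
proof -
  have cu: "continuous_on UNIV u"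
    using d by (meson continuous_at_imp_continuous_on has_vector_derivative_continuous)
  have "(LINT x|Om L. u x * \<phi>' x) = - (LINT x|Om L. g x * \<phi> x)" if t: "test_function L \<phi> \<phi>'" for \<phi> \<phi>'
  proof -
    note ct = test_function_continuous[OF t]
    have c': "continuous_on {0..L} u" "continuous_on {0..L} g"
      using c cu continuous_on_subset by blast+
    have z: "\<phi> 0 = 0" "\<phi> L = 0" using t by (force simp: test_function_def)+
    have "(LINT x|Om L. u x * \<phi>' x + g x * \<phi> x) = u L * \<phi> L - u 0 * \<phi> 0"
    proof (rule integral_Om_derivative)
      show "((\<lambda>x. u x * \<phi> x) has_vector_derivative u x * \<phi>' x + g x * \<phi> x) (at x)" for x
        using t d by (intro has_vector_derivative_mult) (auto simp: test_function_def)
    qed (use assms in \<open>auto intro!: continuous_intros ct c'\<close>)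
    moreover have "(LINT x|Om L. u x * \<phi>' x + g x * \<phi> x) = (LINT x|Om L. u x * \<phi>' x) + (LINT x|Om L. g x * \<phi> x)"
      by (intro Bochner_Integration.integral_add integrable_mult_continuous integrable_Om_continuous c' ct)
    ultimately show ?thesis using z by (simp add: eq_neg_iff_add_eq_0)
  qed
  then show ?thesis
    using c cu by (auto simp: has_weak_derivative_def intro!: L2_continuous elim: continuous_on_subset)
qed

text \<open>
  Test functions are built from one \<open>C\<^sup>1\<close> step. The function \<open>hat\<close> is the tent on \<open>[0, 2]\<close> with peak \<open>1\<close> at
  \<open>1\<close> and integral \<open>1\<close>, and \<open>ramp\<close> is its primitive rising from \<open>0\<close> to \<open>1\<close>. Written with absolute values
  they need no case distinction, because \<open>t \<bar>t\<bar>\<close> is everywhere differentiable with derivative \<open>2 \<bar>t\<bar>\<close>.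
\<close>

definition hat :: "real \<Rightarrow> real" where
  "hat t = (\<bar>t\<bar> - 2 * \<bar>t - 1\<bar> + \<bar>t - 2\<bar>) / 2"

definition ramp :: "real \<Rightarrow> real" where
  "ramp t = 1/2 + (t * \<bar>t\<bar> - 2 * ((t - 1) * \<bar>t - 1\<bar>) + (t - 2) * \<bar>t - 2\<bar>) / 4"

lemma has_real_derivative_mult_abs:
  "((\<lambda>t::real. t * \<bar>t\<bar>) has_real_derivative 2 * \<bar>t\<bar>) (at t)"
proof (cases "t = 0")
  case True
  have "((\<lambda>h::real. \<bar>h\<bar>) \<longlongrightarrow> 0) (at 0)" by (rule tendsto_eq_intros | simp)+
  then have "((\<lambda>h::real. h * \<bar>h\<bar> / h) \<longlongrightarrow> 0) (at 0)"
    by (rule Lim_transform_eventually) (auto simp: eventually_at intro!: exI[of _ 1])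
  then show ?thesis using True by (simp add: DERIV_def)
next
  case False
  have d: "((\<lambda>t::real. s * t\<^sup>2) has_real_derivative s * (2 * t)) (at t)" for s
    by (auto intro!: derivative_eq_intros)
  show ?thesis
  proof (cases "0 < t")
    case True
    show ?thesis
      using has_field_derivative_transform_within_open[OF d[of 1] open_greaterThan[of 0], of "\<lambda>t. t * \<bar>t\<bar>"] True
      by (simp add: power2_eq_square)
  next
    case False
    then show ?thesis
      using has_field_derivative_transform_within_open[OF d[of "-1"] open_lessThan[of 0], of "\<lambda>t. t * \<bar>t\<bar>"] \<open>t \<noteq> 0\<close>
      by (simp add: power2_eq_square)
  qed
qed

lemma ramp_derivative: "(ramp has_real_derivative hat t) (at t)"
proof -
  have s: "((\<lambda>t. (t - a) * \<bar>t - a\<bar>) has_real_derivative 2 * \<bar>t - a\<bar>) (at t)" for a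
  proof -
    have "((\<lambda>t. t - a) has_real_derivative 1) (at t)"
      by (auto intro!: derivative_eq_intros)
    from DERIV_chain2[OF has_real_derivative_mult_abs this] show ?thesis by simp
  qed
  have "((\<lambda>t. 1/2 + (t * \<bar>t\<bar> - 2 * ((t - 1) * \<bar>t - 1\<bar>) + (t - 2) * \<bar>t - 2\<bar>) / 4) has_real_derivative
      0 + (2 * \<bar>t\<bar> - 2 * (2 * \<bar>t - 1\<bar>) + 2 * \<bar>t - 2\<bar>) / 4) (at t)"
    by (intro DERIV_add DERIV_const DERIV_cdivide DERIV_diff DERIV_cmult s has_real_derivative_mult_abs)
  moreover have "0 + (2 * \<bar>t\<bar> - 2 * (2 * \<bar>t - 1\<bar>) + 2 * \<bar>t - 2\<bar>) / 4 = hat t"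
    by (simp add: hat_def field_simps)
  ultimately show ?thesis unfolding ramp_def[abs_def] by simp
qed

lemma ramp_below: "t \<le> 0 \<Longrightarrow> ramp t = 0" by (simp add: ramp_def algebra_simps)
lemma ramp_above: "2 \<le> t \<Longrightarrow> ramp t = 1" by (simp add: ramp_def algebra_simps)
lemma hat_outside: "t \<le> 0 \<or> 2 \<le> t \<Longrightarrow> hat t = 0" by (auto simp: hat_def)
lemma hat_nonneg: "0 \<le> hat t" by (auto simp: hat_def abs_if)

lemma ramp_range: "0 \<le> ramp t" "ramp t \<le> 1"
proof -
  have mono: "ramp x \<le> ramp y" if "x \<le> y" for x y
    using ramp_derivative hat_nonneg by (intro DERIV_nonneg_imp_nondecreasing[OF that]) blast
  show "0 \<le> ramp t" using mono[of "min t 0" t] by (simp add: ramp_below)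
  show "ramp t \<le> 1" using mono[of t "max t 2"] by (simp add: ramp_above)
qed

lemma scaled_ramp_real_derivative:
  "((\<lambda>x. ramp (n * (x - a))) has_real_derivative n * hat (n * (x - a))) (at x)"
proof -
  have "((\<lambda>x. ramp (n * (x - a))) has_real_derivative hat (n * (x - a)) * n) (at x)"
    by (rule DERIV_chain2[OF ramp_derivative]) (auto intro!: derivative_eq_intros)
  then show ?thesis by (simp add: mult.commute)
qed

lemma scaled_ramp_derivative:
  "((\<lambda>x. complex_of_real (ramp (n * (x - a)))) has_vector_derivative
     complex_of_real (n * hat (n * (x - a)))) (at x)"
  by (rule has_vector_derivative_of_real[OF scaled_ramp_real_derivative])

lemma scaled_hat_continuous: "continuous_on S (\<lambda>x. complex_of_real (n * hat (n * (x - a))))"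
  unfolding hat_def by (intro continuous_intros) auto

lemma eventually_two_div_less: "0 < d \<Longrightarrow> \<forall>\<^sub>F n in sequentially. 2 / real n < d"
proof -
  assume "0 < d"
  have "(\<lambda>n. 2 / real n) \<longlonglongrightarrow> 0" by (rule lim_const_over_n)
  then show ?thesis using \<open>0 < d\<close> by (rule order_tendstoD)
qed

text \<open>
  The rescaled tents have integral \<open>1\<close> and live on \<open>[a, a + 2/n]\<close>, where \<open>u\<close> is close to \<open>u a\<close>.
\<close>

lemma approximate_identity:
  fixes u :: "real \<Rightarrow> complex"
  assumes "continuous_on {0..L} u" "0 < a" "a < L"
  shows "(\<lambda>n. LINT x|Om L. u x * of_real (real n * hat (real n * (x - a)))) \<longlonglongrightarrow> u a"
proof (rule tendstoI)
  fix e :: real assume "0 < e"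
  obtain d where d: "0 < d" "\<And>x. x \<in> {0..L} \<Longrightarrow> dist x a < d \<Longrightarrow> dist (u x) (u a) < e / 2"
    using assms \<open>0 < e\<close> unfolding continuous_on_iff by (metis atLeastAtMost_iff half_gt_zero less_eq_real_def)
  have "\<forall>\<^sub>F n in sequentially. 2 / real n < min d (L - a) \<and> n > 0"
    using eventually_two_div_less[of "min d (L - a)"] eventually_gt_at_top[of 0] d assms by (auto simp: eventually_conj_iff)
  then show "\<forall>\<^sub>F n in sequentially.
      dist (LINT x|Om L. u x * of_real (real n * hat (real n * (x - a)))) (u a) < e"
  proof eventually_elim
    case (elim n)
    let ?d = "\<lambda>x. real n * hat (real n * (x - a))"
    have n: "0 < n" "2 / n < d" "2 < n * (L - a)" using elim by (auto simp: field_simps)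
    have cd: "continuous_on {0..L} ?d" unfolding hat_def by (intro continuous_intros) auto
    have "integral\<^sup>L (Om L) ?d = ramp (n * (L - a)) - ramp (n * (0 - a))"
    proof (rule integral_Om_derivative)
      show "((\<lambda>x. ramp (n * (x - a))) has_vector_derivative ?d x) (at x)" for x
        using scaled_ramp_real_derivative by (simp add: has_real_derivative_iff_has_vector_derivative)
    qed (use assms cd in auto)
    also have "\<dots> = 1" using n assms by (simp add: ramp_above ramp_below)
    finally have I: "integral\<^sup>L (Om L) ?d = 1" .
    have ii: "integrable (Om L) (\<lambda>x. u x * of_real (?d x))"
      by (intro integrable_Om_continuous continuous_intros assms scaled_hat_continuous)
    have i3: "integrable (Om L) (\<lambda>x. u a * of_real (?d x))"
      by (intro integrable_Om_continuous continuous_intros assms scaled_hat_continuous)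
    have "(LINT x|Om L. u a * of_real (?d x)) = u a"
      using I by (simp del: of_real_mult)
    then have "(LINT x|Om L. u x * of_real (?d x)) - u a = (LINT x|Om L. (u x - u a) * of_real (?d x))"
      using Bochner_Integration.integral_diff[OF ii i3] by (simp add: left_diff_distrib)
    also have "norm \<dots> \<le> (LINT x|Om L. e / 2 * ?d x)"
    proof (rule Bochner_Integration.integral_norm_bound_integral)
      show "integrable (Om L) (\<lambda>x. (u x - u a) * of_real (?d x))"
        using Bochner_Integration.integrable_diff[OF ii i3] by (simp add: left_diff_distrib)
      show "integrable (Om L) (\<lambda>x. e / 2 * ?d x)"
        using integrable_Om_continuous[OF cd] by auto
      fix x assume "x \<in> space (Om L)"
      then have x: "x \<in> {0..L}" by auto
      show "norm ((u x - u a) * of_real (?d x)) \<le> e / 2 * ?d x"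
      proof (cases "dist x a < d")
        case True
        then have "norm (u x - u a) \<le> e / 2" using d(2)[OF x] by (simp add: dist_norm)
        then have "norm (u x - u a) * ?d x \<le> e / 2 * ?d x"
          by (intro mult_right_mono) (auto simp: hat_nonneg)
        then show ?thesis by (simp add: norm_mult hat_nonneg abs_mult)
      next
        case False
        have "n * (x - a) \<le> 0 \<or> 2 \<le> n * (x - a)"
        proof (cases "x \<le> a")
          case True
          then show ?thesis by (simp add: mult_nonneg_nonpos)
        next
          case 2: False
          have "2 < n * d" using n by (simp add: field_simps)
          also have "n * d \<le> n * (x - a)"
            using False 2 by (intro mult_left_mono) (auto simp: dist_real_def)
          finally show ?thesis by simp
        qed
        then show ?thesis by (simp add: hat_outside)
      qed
    qed
    also have "\<dots> = e / 2" using I by simp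
    finally show ?case using \<open>0 < e\<close> by (simp add: dist_norm)
  qed
qed

lemma ramp_tendsto_indicator:
  "(\<lambda>n. ramp (real n * (x - a))) \<longlonglongrightarrow> (if a < x then 1 else 0)"
proof (cases "a < x")
  case True
  then have "\<forall>\<^sub>F n in sequentially. 2 / real n < x - a \<and> n > 0"
    using eventually_two_div_less[of "x - a"] eventually_gt_at_top[of 0] by (auto simp: eventually_conj_iff)
  then have "\<forall>\<^sub>F n in sequentially. ramp (real n * (x - a)) = 1"
    by eventually_elim (auto intro!: ramp_above simp: field_simps)
  then show ?thesis using True by (simp add: tendsto_eventually)
next
  case False
  then show ?thesis by (simp add: ramp_below mult_nonneg_nonpos)
qed

text \<open>
  Testing with \<open>ramp (n (x - a)) - ramp (n (x - b))\<close>, a smoothed indicator function of \<open>(a, b]\<close>, and letting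
  \<open>n\<close> tend to infinity: the derivatives of the two steps pick out \<open>u a\<close> and \<open>u b\<close>, and dominated
  convergence treats the side of the weak derivative.
\<close>

lemma weak_derivative_increment:
  assumes w: "has_weak_derivative L u g" and u: "continuous_on {0..L} u" and "0 < a" "a \<le> b" "b < L"
  shows "u b - u a = (LINT x|Om L. g x * indicator {a<..b} x)"
proof -
  let ?r = "\<lambda>n a x. complex_of_real (ramp (real n * (x - a)))"
  let ?h = "\<lambda>n a x. complex_of_real (real n * hat (real n * (x - a)))"
  let ?\<phi> = "\<lambda>n x. ?r n a x - ?r n b x"
  have g: "g \<in> L2 L" using w by (simp add: has_weak_derivative_def)
  have "(\<lambda>n. (LINT x|Om L. u x * ?h n a x) - (LINT x|Om L. u x * ?h n b x)) \<longlonglongrightarrow> u a - u b"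
    using assms by (intro tendsto_diff approximate_identity) auto
  moreover have "\<forall>\<^sub>F n in sequentially. 2 / real n < L - b \<and> n > 0"
    using eventually_two_div_less[of "L - b"] eventually_gt_at_top[of 0] assms by (auto simp: eventually_conj_iff)
  then have "\<forall>\<^sub>F n in sequentially. (LINT x|Om L. u x * ?h n a x) - (LINT x|Om L. u x * ?h n b x)
      = - (LINT x|Om L. g x * ?\<phi> n x)"
  proof eventually_elim
    case (elim n)
    have "test_function L (?\<phi> n) (\<lambda>x. ?h n a x - ?h n b x)"
      unfolding test_function_def
    proof (intro conjI allI)
      show "(?\<phi> n has_vector_derivative ?h n a x - ?h n b x) (at x)" for x
        by (intro has_vector_derivative_diff scaled_ramp_derivative)
      show "continuous_on UNIV (\<lambda>x. ?h n a x - ?h n b x)"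
        by (intro continuous_on_diff scaled_hat_continuous)
      show "\<exists>c d. 0 < c \<and> d < L \<and> (\<forall>x. x \<notin> {c..d} \<longrightarrow> ?\<phi> n x = 0)"
      proof (intro exI conjI allI impI)
        show "0 < a" by fact
        show "b + 2 / n < L" using elim by auto
        fix x assume x: "x \<notin> {a..b + 2 / n}"
        show "?\<phi> n x = 0"
        proof (cases "x < a")
          case True
          then show ?thesis using assms elim by (simp add: ramp_below mult_nonneg_nonpos)
        next
          case False
          then have "2 \<le> n * (x - b)" using x elim by (auto simp: field_simps)
          moreover have "n * (x - b) \<le> n * (x - a)" using assms by (simp add: mult_left_mono)
          ultimately show ?thesis by (simp add: ramp_above)
        qed
      qed
    qed
    then have "(LINT x|Om L. u x * (?h n a x - ?h n b x)) = - (LINT x|Om L. g x * ?\<phi> n x)"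
      using w by (simp add: has_weak_derivative_def)
    moreover have "(LINT x|Om L. u x * (?h n a x - ?h n b x))
        = (LINT x|Om L. u x * ?h n a x) - (LINT x|Om L. u x * ?h n b x)"
      by (subst Bochner_Integration.integral_diff[symmetric])
         (auto simp only: right_diff_distrib[of "u x" "?h n a x" "?h n b x" for x]
           intro!: integrable_Om_continuous continuous_on_mult[OF u scaled_hat_continuous])
    ultimately show ?case by simp
  qed
  ultimately have "(\<lambda>n. - (LINT x|Om L. g x * ?\<phi> n x)) \<longlonglongrightarrow> u a - u b"
    by (rule Lim_transform_eventually)
  then have 1: "(\<lambda>n. LINT x|Om L. g x * ?\<phi> n x) \<longlonglongrightarrow> u b - u a"
    using tendsto_minus by fastforce
  have 2: "(\<lambda>n. LINT x|Om L. g x * ?\<phi> n x) \<longlonglongrightarrow> (LINT x|Om L. g x * indicator {a<..b} x)"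
  proof (rule integral_dominated_convergence)
    note [measurable] = L2_measurable[OF g]
    have [measurable]: "?\<phi> n \<in> borel_measurable (Om L)" for n
      by (intro measurable_Om_continuous continuous_at_imp_continuous_on)
         (auto intro!: continuous_intros has_vector_derivative_continuous[OF scaled_ramp_derivative])
    have [measurable]: "(\<lambda>x. indicator {a<..b} x :: complex) \<in> borel_measurable (Om L)"
      by (rule borel_measurable_indicator) (use assms in \<open>auto simp: sets_restrict_space_iff\<close>)
    show "(\<lambda>x. g x * indicator {a<..b} x) \<in> borel_measurable (Om L)"
      by measurable
    show "(\<lambda>x. g x * ?\<phi> n x) \<in> borel_measurable (Om L)" for n by measurable
    show "integrable (Om L) (\<lambda>x. cmod (g x))" using L2_integrable[OF g] by simp
    show "AE x in Om L. (\<lambda>n. g x * ?\<phi> n x) \<longlonglongrightarrow> g x * indicator {a<..b} x"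
    proof (rule AE_I2)
      fix x
      have "(\<lambda>n. ramp (real n * (x - a)) - ramp (real n * (x - b))) \<longlonglongrightarrow> (if a < x then 1 else 0) - (if b < x then 1 else 0)"
        by (intro tendsto_diff ramp_tendsto_indicator)
      then have "(\<lambda>n. ?\<phi> n x) \<longlonglongrightarrow> of_real ((if a < x then 1 else 0) - (if b < x then 1 else 0))"
        unfolding of_real_diff[symmetric] by (rule tendsto_of_real)
      also have "of_real ((if a < x then 1 else 0) - (if b < x then 1 else 0)) = (indicator {a<..b} x :: complex)"
        using assms by (auto simp: indicator_def)
      finally show "(\<lambda>n. g x * ?\<phi> n x) \<longlonglongrightarrow> g x * indicator {a<..b} x"
        by (intro tendsto_mult tendsto_const)
    qed
    show "AE x in Om L. norm (g x * ?\<phi> n x) \<le> cmod (g x)" for n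
    proof (rule AE_I2)
      fix x
      have "cmod (?\<phi> n x) = \<bar>ramp (real n * (x - a)) - ramp (real n * (x - b))\<bar>"
        unfolding of_real_diff[symmetric] norm_of_real ..
      also have "\<dots> \<le> 1" using ramp_range[of "real n * (x - a)"] ramp_range[of "real n * (x - b)"] by auto
      finally show "norm (g x * ?\<phi> n x) \<le> cmod (g x)" by (simp add: norm_mult mult_left_le)
    qed
  qed
  show ?thesis using LIMSEQ_unique[OF 1 2] .
qed

text \<open>
  By the Lebesgue differentiation theorem \<open>h x\<close> is, for almost every \<open>x\<close>, the limit of the averages of \<open>h\<close>
  over \<open>[x, x + k]\<close>, and these all vanish.
\<close>

lemma AE_zero_of_interval_integrals:
  fixes h :: "real \<Rightarrow> complex"
  assumes h: "integrable (Om L) h"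
    and z: "\<And>a b. 0 < a \<Longrightarrow> a \<le> b \<Longrightarrow> b < L \<Longrightarrow> (LINT x|Om L. h x * indicator {a<..b} x) = 0"
  shows "AE x in Om L. h x = 0"
proof -
  define H where "H x = (if x \<in> {0<..<L} then h x else 0)" for x
  have HL: "integrable lebesgue H"
    using h by (subst (asm) integrable_restrict_space)
      (auto simp: H_def indicator_def if_distrib cong: if_cong elim!: back_subst[of "integrable lebesgue"])
  have Hon: "H integrable_on S" if "S \<in> sets lebesgue" for S
  proof -
    have "set_integrable lebesgue S H" unfolding set_integrable_def using HL that
      by (rule integrable_mult_indicator[rotated])
    then show ?thesis by (simp add: set_lebesgue_integral_eq_integral)
  qed
  have z': "integral {a..b} H = 0" if "0 < a" "a \<le> b" "b < L" for a b
  proof -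
    have "integral {a..b} H = integral {a<..b} H"
      by (rule integral_subset_negligible[symmetric])
         (auto intro!: negligible_subset[OF negligible_sing[of a]])
    also have "\<dots> = (LINT x:{a<..b}|lebesgue. H x)"
      by (rule set_lebesgue_integral_eq_integral(2)[symmetric])
         (auto simp: set_integrable_def intro!: integrable_mult_indicator HL)
    also have "\<dots> = (LINT x|Om L. h x * indicator {a<..b} x)"
      unfolding set_lebesgue_integral_def
      by (subst integral_restrict_space) (auto simp: H_def indicator_def intro!: Bochner_Integration.integral_cong)
    finally show ?thesis using z[OF that] by simp
  qed
  obtain N where N: "negligible N" "\<And>x e. \<lbrakk>x \<notin> N; 0 < e\<rbrakk> \<Longrightarrow>
      \<exists>d>0. \<forall>k. 0 < k \<and> k < d \<longrightarrow> norm (integral (cbox x (x + k *\<^sub>R One)) H /\<^sub>R k ^ DIM(real) - H x) < e"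
    using integrable_ccontinuous_explicit[of H] Hon by (metis lmeasurable_cbox fmeasurableD)
  have "h x = 0" if x: "x \<in> {0<..<L}" "x \<notin> N" for x
  proof (rule ccontr)
    assume "h x \<noteq> 0"
    then obtain d where d: "d > 0" "\<And>k. 0 < k \<Longrightarrow> k < d \<Longrightarrow> norm (integral {x..x+k} H / k - H x) < norm (h x)"
      using N(2)[OF x(2), of "norm (h x)"] by (auto simp: scaleR_conv_of_real divide_inverse mult.commute)
    define k where "k = min (d / 2) ((L - x) / 2)"
    have "0 < k" "k < d" "x + k < L" using d x by (auto simp: k_def min_def field_simps)
    then show False using d(2)[of k] z'[of x "x + k"] x by (simp add: H_def)
  qed
  then have "AE x in lebesgue. x \<in> {0<..<L} \<longrightarrow> h x = 0"
    using N(1) by (intro AE_I'[of N]) (auto simp: negligible_iff_null_sets)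
  then show ?thesis by (subst AE_restrict_space_iff) auto
qed

lemma weak_derivative_unique:
  assumes "continuous_on {0..L} u" "has_weak_derivative L u g" "has_weak_derivative L u h"
  shows "AE x in Om L. g x = h x"
proof -
  have gh: "g \<in> L2 L" "h \<in> L2 L" using assms by (auto simp: has_weak_derivative_def)
  have "AE x in Om L. g x - h x = 0"
  proof (rule AE_zero_of_interval_integrals)
    show "integrable (Om L) (\<lambda>x. g x - h x)" using gh by (auto intro: L2_integrable)
    fix a b assume ab: "0 < a" "a \<le> b" "b < L"
    have i: "integrable (Om L) (\<lambda>x. f x * indicator {a<..b} x)" if "f \<in> L2 L" for f
    proof -
      have "integrable (Om L) (\<lambda>x. indicator {a<..b} x *\<^sub>R f x)"
        by (rule integrable_mult_indicator) (use ab L2_integrable[OF that] in \<open>auto simp: sets_restrict_space_iff\<close>)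
      then show ?thesis by (simp add: scaleR_conv_of_real of_real_indicator mult.commute)
    qed
    show "(LINT x|Om L. (g x - h x) * indicator {a<..b} x) = 0"
      using weak_derivative_increment[OF assms(2,1) ab] weak_derivative_increment[OF assms(3,1) ab]
        Bochner_Integration.integral_diff[OF i i, OF gh] by (simp add: left_diff_distrib)
  qed
  then show ?thesis by simp
qed

text \<open>
  For \<open>0 < a < b\<close> the increment formula gives \<open>\<bar>u b - u a\<bar> \<le> I\<close> with \<open>I\<close> the integral of \<open>\<bar>g\<bar>\<close>. Letting \<open>a\<close>
  tend to \<open>0\<close> bounds \<open>\<bar>u\<bar>\<close> by \<open>I\<close>, and \<open>I\<^sup>2\<close> is at most \<open>L\<close> times the squared norm of \<open>g\<close>.
\<close>

lemma Poincare:
  assumes "0 < L" "has_weak_derivative L u g" "continuous_on {0..L} u" "u 0 = 0"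
  shows "L2_sq L u \<le> L\<^sup>2 * L2_sq L g"
proof -
  have g: "g \<in> L2 L" "u \<in> L2 L" using assms by (auto simp: has_weak_derivative_def)
  define I where "I = (LINT x|Om L. cmod (g x))"
  have b: "cmod (u b) \<le> I" if b: "b \<in> {0<..<L}" for b
  proof (rule tendsto_upperbound)
    have "continuous (at 0 within {0..L}) u" using assms by (auto simp: continuous_on_eq_continuous_within)
    then have "(u \<longlongrightarrow> 0) (at 0 within {0..L})" using assms by (simp add: continuous_within)
    then have "(u \<longlongrightarrow> 0) (at 0 within {0<..<b})" by (rule tendsto_within_subset) (use b in auto)
    then have "((\<lambda>a. cmod (u b - u a)) \<longlongrightarrow> cmod (u b - 0)) (at 0 within {0<..<b})"
      by (intro tendsto_intros)
    then show "((\<lambda>a. cmod (u b - u a)) \<longlongrightarrow> cmod (u b)) (at 0 within {0<..<b})" by simp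
    show "\<forall>\<^sub>F a in at 0 within {0<..<b}. cmod (u b - u a) \<le> I"
    proof (rule eventually_at_topological[THEN iffD2], intro exI[of _ UNIV] conjI ballI impI)
      fix a assume a: "a \<in> {0<..<b}"
      have "cmod (u b - u a) = cmod (LINT x|Om L. g x * indicator {a<..b} x)"
        using weak_derivative_increment[OF assms(2,3), of a b] a b by simp
      also have "\<dots> \<le> (LINT x|Om L. cmod (g x * indicator {a<..b} x))" by (rule Bochner_Integration.integral_norm_bound)
      also have "\<dots> \<le> I"
        unfolding I_def
      proof (rule integral_mono')
        show "integrable (Om L) (\<lambda>x. cmod (g x))" using L2_integrable[OF g(1)] by simp
      qed (auto simp: norm_mult indicator_def)
      finally show "cmod (u b - u a) \<le> I" .
    qed auto
    show "at 0 within {0<..<b} \<noteq> bot" using b by (simp add: at_within_eq_bot_iff trivial_limit_within islimpt_greaterThanLessThan1)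
  qed
  have "L2_sq L u \<le> L * I\<^sup>2"
    using b g assms by (intro L2_sq_bounded) auto
  also have "\<dots> \<le> L * (L * L2_sq L g)"
    using integral_norm_squared_le[OF assms(1) g(1)] assms(1) by (simp add: I_def)
  finally show ?thesis by (simp add: power2_eq_square)
qed

section \<open>Weak derivatives with continuous representatives\<close>

text \<open>
  Inside the interval the set where \<open>f\<close> and \<open>g\<close> differ is open and null, hence empty; the end points
  follow by continuity.
\<close>

lemma continuous_AE_eq:
  fixes f g :: "real \<Rightarrow> complex"
  assumes "0 < L" "continuous_on {0..L} f" "continuous_on {0..L} g" "AE x in Om L. f x = g x"
    and x: "x \<in> {0..L}"
  shows "f x = g x"
proof -
  let ?S = "{x \<in> {0<..<L}. f x - g x \<in> - {0}}"
  have "open ?S"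
  proof -
    have "continuous_on {0<..<L} (\<lambda>x. f x - g x)"
      by (intro continuous_intros continuous_on_subset[OF assms(2)] continuous_on_subset[OF assms(3)]) auto
    from continuous_open_preimage[OF this, of "- {0}"] show ?thesis by (simp add: vimage_def Int_def open_Compl)
  qed
  moreover have "?S \<in> null_sets lebesgue"
  proof -
    have "AE x in lebesgue. x \<in> {0<..<L} \<longrightarrow> f x = g x"
      using assms(4) by (subst (asm) AE_restrict_space_iff) auto
    then have "AE x in lebesgue. x \<notin> ?S" by (auto elim: eventually_mono)
    moreover have "?S \<in> sets lebesgue" using \<open>open ?S\<close> by auto
    ultimately show ?thesis by (simp add: AE_iff_null_sets)
  qed
  then have "negligible ?S" by (simp add: negligible_iff_null_sets)
  ultimately have e: "?S = {}" using open_not_negligible by blast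
  have cl: "closure {0<..<L} = {0..L}" using assms(1) by simp
  have "f x - g x = 0"
  proof (rule continuous_constant_on_closure[of "{0<..<L}" "\<lambda>x. f x - g x"])
    show "continuous_on (closure {0<..<L}) (\<lambda>x. f x - g x)"
      unfolding cl by (intro continuous_intros assms)
    show "x \<in> closure {0<..<L}" unfolding cl by (rule x)
    show "\<And>x. x \<in> {0<..<L} \<Longrightarrow> f x - g x = 0" using e by auto
  qed
  then show ?thesis by simp
qed

lemma wderiv_weak_derivative:
  assumes "has_weak_derivative L u g" shows "has_weak_derivative L u (wderiv L u)"
proof -
  let ?P = "\<lambda>g. has_weak_derivative L u g \<and>
     ((\<exists>w. has_weak_derivative L u w \<and> continuous_on {0..L} w) \<longrightarrow> continuous_on {0..L} g)"
  have "\<exists>g. ?P g" using assms by blast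
  then have "?P (wderiv L u)" unfolding wderiv_def by (rule someI_ex)
  then show ?thesis by blast
qed

lemma wderiv_continuous:
  assumes "has_weak_derivative L u g" "continuous_on {0..L} g"
  shows "continuous_on {0..L} (wderiv L u)"
proof -
  let ?P = "\<lambda>g. has_weak_derivative L u g \<and>
     ((\<exists>w. has_weak_derivative L u w \<and> continuous_on {0..L} w) \<longrightarrow> continuous_on {0..L} g)"
  have "\<exists>g. ?P g" using assms by blast
  then have "?P (wderiv L u)" unfolding wderiv_def by (rule someI_ex)
  then show ?thesis using assms by blast
qed

lemma wderiv_AE:
  assumes "continuous_on {0..L} u" "has_weak_derivative L u g"
  shows "AE x in Om L. wderiv L u x = g x"
  using weak_derivative_unique[OF assms(1) wderiv_weak_derivative[OF assms(2)] assms(2)] .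

text \<open>
  This identifies the trace \<open>u'(L)\<close> in the damping condition for concrete functions \<open>u\<close>.
\<close>

lemma wderiv_eq:
  assumes "0 < L" "continuous_on {0..L} u" "has_weak_derivative L u g" "continuous_on {0..L} g" "x \<in> {0..L}"
  shows "wderiv L u x = g x"
  by (rule continuous_AE_eq[OF assms(1) wderiv_continuous[OF assms(3,4)] assms(4) wderiv_AE[OF assms(2,3)] assms(5)])

lemma H1_inner_self:
  assumes "continuous_on {0..L} u" "has_weak_derivative L u g"
  shows "H1_inner L u u = of_real (L2_sq L u + L2_sq L g)"
proof -
  have "L2_sq L (wderiv L u) = L2_sq L g"
  proof (rule L2_sq_cong_AE[OF _ _ wderiv_AE[OF assms]])
    show "wderiv L u \<in> borel_measurable (Om L)" "g \<in> borel_measurable (Om L)"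
      using wderiv_weak_derivative[OF assms(2)] assms(2) by (auto simp: has_weak_derivative_def L2_measurable)
  qed
  then show ?thesis by (simp add: H1_inner_def L2_inner_self)
qed

text \<open>
  The increment formula exhibits \<open>u\<close> as an indefinite integral of the continuous function \<open>p\<close>.
\<close>

lemma weak_derivative_imp_derivative:
  assumes w: "has_weak_derivative L u p" and u: "continuous_on {0..L} u" and p: "continuous_on {0..L} p"
    and x: "x \<in> {0<..<L}"
  shows "(u has_vector_derivative p x) (at x)"
proof -
  define a b where "a = x / 2" and "b = (x + L) / 2"
  have ab: "0 < a" "a < x" "x < b" "b < L" using x by (auto simp: a_def b_def field_simps)
  have cp: "continuous_on {a..b} p" using p by (rule continuous_on_subset) (use ab in auto)
  have eq: "u a + integral {a..y} p = u y" if y: "y \<in> {a<..<b}" for y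
  proof -
    have cy: "continuous_on {a..y} p" using cp by (rule continuous_on_subset) (use y in auto)
    have "(LINT t|Om L. p t * indicator {a<..y} t) = (LINT t:{a<..y}|lebesgue. p t)"
      unfolding set_lebesgue_integral_def
      by (subst integral_restrict_space) (use ab y in \<open>auto simp: indicator_def intro!: Bochner_Integration.integral_cong\<close>)
    also have "\<dots> = integral {a<..y} p"
    proof (rule set_lebesgue_integral_eq_integral(2))
      show "set_integrable lebesgue {a<..y} p"
        using absolutely_integrable_continuous_real[OF cy] by (rule set_integrable_subset) auto
    qed
    also have "\<dots> = integral {a..y} p"
      by (rule integral_subset_negligible) (auto intro!: negligible_subset[OF negligible_sing[of a]])
    finally show ?thesis using weak_derivative_increment[OF w u, of a y] ab y by (simp add: algebra_simps)
  qed
  have "((\<lambda>y. integral {a..y} p) has_vector_derivative p x) (at x within {a..b})"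
    by (rule integral_has_vector_derivative[OF cp]) (use ab in auto)
  then have "((\<lambda>y. u a + integral {a..y} p) has_vector_derivative p x) (at x)"
    using at_within_Icc_at[of a x b] ab by (auto intro!: derivative_eq_intros)
  then show ?thesis
    by (rule has_vector_derivative_transform_within_open[of _ _ _ "{a<..<b}"]) (use ab eq in auto)
qed

text \<open>
  The function \<open>p + s u\<close> satisfies \<open>(p + s u)' = s (p + s u)\<close>. Used with both signs of \<open>s\<close>, this determines \<open>u\<close>
  and \<open>u'\<close> from \<open>u'(0)\<close>. As \<open>u\<close> and \<open>p\<close> are continuous, the weak equations hold classically in the interior.
\<close>

lemma second_order_ode:
  assumes "0 < L" and u: "has_weak_derivative L u p" "continuous_on {0..L} u"
    and p: "has_weak_derivative L p q" "continuous_on {0..L} p"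
    and q: "AE x in Om L. q x = s\<^sup>2 * u x" and x: "x \<in> {0..L}"
  shows "p x + s * u x = (p 0 + s * u 0) * exp (s * of_real x)"
proof -
  have cq: "continuous_on {0..L} (\<lambda>x. s\<^sup>2 * u x)" by (intro continuous_intros u)
  have wq: "has_weak_derivative L p (\<lambda>x. s\<^sup>2 * u x)"
    by (rule weak_derivative_cong_AE[OF p(1) measurable_Om_continuous[OF cq] q])
  \<comment> \<open>the integrating factor makes the first order equation say that \<open>h\<close> is constant\<close>
  define h where "h x = exp (- (s * of_real x)) * (p x + s * u x)" for x
  have "h x = h 0"
  proof (rule has_derivative_zero_unique_strong_interval[of "{0, L}" 0 L])
    show "continuous_on {0..L} h" unfolding h_def by (intro continuous_intros u p)
    fix y assume "y \<in> {0..L} - {0, L}"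
    then have y: "y \<in> {0<..<L}" by auto
    have du: "(u has_vector_derivative p y) (at y)" by (rule weak_derivative_imp_derivative[OF u p(2) y])
    have dp: "(p has_vector_derivative s\<^sup>2 * u y) (at y)" by (rule weak_derivative_imp_derivative[OF wq p(2) cq y])
    have dl: "((\<lambda>y. - (s * of_real y)) has_vector_derivative - s) (at y)"
      by (auto intro!: derivative_eq_intros simp: has_vector_derivative_def scaleR_conv_of_real)
    have de: "((\<lambda>y. exp (- (s * of_real y))) has_vector_derivative - s * exp (- (s * of_real y))) (at y)"
      using field_vector_diff_chain_at[OF dl DERIV_exp] by (simp add: o_def)
    have "(h has_vector_derivative exp (- (s * of_real y)) * (s\<^sup>2 * u y + s * p y)
        + (- s * exp (- (s * of_real y))) * (p y + s * u y)) (at y)"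
      unfolding h_def by (intro has_vector_derivative_mult de has_vector_derivative_add dp
          has_vector_derivative_mult_right du)
    then have "(h has_vector_derivative 0) (at y)" by (simp add: algebra_simps power2_eq_square)
    then show "(h has_derivative (\<lambda>h. 0)) (at y within {0..L})"
      by (auto simp: has_vector_derivative_def intro: has_derivative_at_withinI)
  qed (use x in auto)
  then have "exp (s * of_real x) * (exp (- (s * of_real x)) * (p x + s * u x)) = exp (s * of_real x) * (p 0 + s * u 0)"
    by (simp add: h_def)
  then show ?thesis unfolding mult.assoc[symmetric] exp_add[symmetric] by (simp add: mult.commute)
qed

section \<open>Density of continuous functions\<close>

text \<open>
  The radial projection onto the disc of radius \<open>M\<close>. It is continuous, so it can be applied to a function and
  to its continuous approximations alike.
\<close>

definition truncate :: "real \<Rightarrow> complex \<Rightarrow> complex" where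
  "truncate M z = z /\<^sub>R max 1 (cmod z / M)"

lemma truncate_id: "0 < M \<Longrightarrow> cmod z \<le> M \<Longrightarrow> truncate M z = z"
  by (simp add: truncate_def max_def field_simps)

lemma cmod_truncate_le: assumes "0 < M" shows "cmod (truncate M z) \<le> M"
proof -
  have "cmod z \<le> M * max 1 (cmod z / M)"
    using assms by (auto simp: max_def field_simps)
  then show ?thesis
    using assms by (simp add: truncate_def divide_inverse[symmetric] field_simps max_def)
qed

lemma cmod_diff_truncate_le: "cmod (z - truncate M z) \<le> cmod z"
proof -
  define m where "m = max 1 (cmod z / M)"
  have "1 \<le> m" by (simp add: m_def)
  then have i: "0 \<le> 1 - inverse m" "1 - inverse m \<le> 1" by (auto simp: field_simps)
  have "z - truncate M z = (1 - inverse m) *\<^sub>R z" by (simp add: truncate_def m_def algebra_simps)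
  then have "cmod (z - truncate M z) = (1 - inverse m) * cmod z" using i by simp
  also have "\<dots> \<le> cmod z" using i by (simp add: mult_left_le_one_le)
  finally show ?thesis .
qed

lemma truncate_continuous: "0 < M \<Longrightarrow> continuous_on S (truncate M)"
  unfolding truncate_def by (intro continuous_intros) (auto simp: max_def)

lemma truncate_L2: assumes "f \<in> L2 L" "0 < M" shows "(\<lambda>x. truncate M (f x)) \<in> L2 L"
proof -
  have m: "(\<lambda>x. truncate M (f x)) \<in> borel_measurable (Om L)"
    using measurable_compose[OF L2_measurable[OF assms(1)] borel_measurable_continuous_onI[OF truncate_continuous[OF assms(2)]]] .
  have "integrable (Om L) (\<lambda>x. (cmod (truncate M (f x)))\<^sup>2)"
  proof (rule Bochner_Integration.integrable_bound[OF integrable_Om_const[of L "M\<^sup>2"]])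
    show "AE x in Om L. norm ((cmod (truncate M (f x)))\<^sup>2) \<le> norm (M\<^sup>2)"
      using cmod_truncate_le[OF assms(2)] by (auto intro!: power_mono)
  qed (use m in measurable)
  then show ?thesis using m by (simp add: L2_def)
qed

lemma truncate_L2_approx:
  assumes "f \<in> L2 L" "0 < e"
  shows "\<exists>M>0. L2_sq L (\<lambda>x. f x - truncate M (f x)) < e"
proof -
  have "(\<lambda>n. L2_sq L (\<lambda>x. f x - truncate (real (Suc n)) (f x))) \<longlonglongrightarrow> (LINT x|Om L. 0)"
    unfolding L2_sq_def
  proof (rule integral_dominated_convergence)
    show "integrable (Om L) (\<lambda>x. (cmod (f x))\<^sup>2)" using assms(1) by (rule L2_square_integrable)
    show "(\<lambda>x. (cmod (f x - truncate (real (Suc n)) (f x)))\<^sup>2) \<in> borel_measurable (Om L)" for n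
      using L2_measurable[OF L2_diff[OF assms(1) truncate_L2[OF assms(1), of "real (Suc n)"]]] by measurable
    show "AE x in Om L. (\<lambda>n. (cmod (f x - truncate (real (Suc n)) (f x)))\<^sup>2) \<longlonglongrightarrow> 0"
    proof (rule AE_I2)
      fix x
      obtain N :: nat where "cmod (f x) \<le> N" using real_arch_simple by blast
      then have "\<forall>\<^sub>F n in sequentially. truncate (real (Suc n)) (f x) = f x"
        unfolding eventually_sequentially by (intro exI[of _ N]) (auto intro!: truncate_id)
      then show "(\<lambda>n. (cmod (f x - truncate (real (Suc n)) (f x)))\<^sup>2) \<longlonglongrightarrow> 0"
        by (intro tendsto_eventually) (auto elim: eventually_mono)
    qed
    show "AE x in Om L. norm ((cmod (f x - truncate (real (Suc n)) (f x)))\<^sup>2) \<le> (cmod (f x))\<^sup>2" for n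
      using cmod_diff_truncate_le by (auto intro!: power_mono)
  qed auto
  then have "\<forall>\<^sub>F n in sequentially. L2_sq L (\<lambda>x. f x - truncate (real (Suc n)) (f x)) < e"
    using assms(2) by (intro order_tendstoD) auto
  then obtain n where "L2_sq L (\<lambda>x. f x - truncate (real (Suc n)) (f x)) < e"
    by (auto dest: eventually_happens)
  then show ?thesis by (intro exI[of _ "real (Suc n)"] conjI) auto
qed

text \<open>
  After truncation \<open>f\<close> may be taken bounded. It is an almost everywhere limit of continuous functions \<open>g\<^sub>n\<close>, and
  truncating these as well makes the convergence dominated. The factors \<open>\<eta>\<^sub>n\<close>, which vanish at the end points and
  tend to \<open>1\<close> inside, provide the boundary values. Those are needed for gluing two such functions to a
  continuous periodic one.
\<close>

lemma continuous_dense_L2: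
  assumes "0 < L" "f \<in> L2 L" "0 < e"
  shows "\<exists>w. continuous_on UNIV w \<and> w 0 = 0 \<and> w L = 0 \<and> L2_sq L (\<lambda>x. f x - w x) < e"
proof -
  obtain M where M: "M > 0" "L2_sq L (\<lambda>x. f x - truncate M (f x)) < e / 4"
    using truncate_L2_approx[OF assms(2), of "e / 4"] assms(3) by auto
  have "f measurable_on {0<..<L}"
    using L2_measurable[OF assms(2)] by (subst measurable_on_iff_borel_measurable) auto
  then obtain N g where N: "negligible N" and g: "\<And>n. continuous_on UNIV (g n)"
    and lim: "\<And>x. x \<notin> N \<Longrightarrow> (\<lambda>n. g n x) \<longlonglongrightarrow> (if x \<in> {0<..<L} then f x else 0)"
    unfolding measurable_on_def by metis
  \<comment> \<open>a cutoff that is \<open>1\<close> at distance at least \<open>1/n\<close> from both end points\<close>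
  define \<eta> where "\<eta> n x = max 0 (min 1 (real n * min x (L - x)))" for n x
  define w where "w n x = complex_of_real (\<eta> n x) * truncate M (g n x)" for n x
  have cw: "continuous_on UNIV (w n)" for n
    unfolding w_def \<eta>_def
    by (intro continuous_intros continuous_on_compose2[OF truncate_continuous[OF M(1)] g]) auto
  have w2: "w n \<in> L2 L" for n by (rule L2_continuous) (rule continuous_on_subset[OF cw], simp)
  note t2 = truncate_L2[OF assms(2) M(1)]
  have wM: "cmod (w n x) \<le> M" for n x
  proof -
    have "cmod (w n x) \<le> 1 * M" unfolding w_def norm_mult
      by (intro mult_mono cmod_truncate_le M) (auto simp: \<eta>_def)
    then show ?thesis by simp
  qed
  have "(\<lambda>n. L2_sq L (\<lambda>x. truncate M (f x) - w n x)) \<longlonglongrightarrow> (LINT x|Om L. 0)"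
    unfolding L2_sq_def
  proof (rule integral_dominated_convergence)
    show "integrable (Om L) (\<lambda>x. (2 * M)\<^sup>2)" by (rule integrable_Om_const)
    show "(\<lambda>x. (cmod (truncate M (f x) - w n x))\<^sup>2) \<in> borel_measurable (Om L)" for n
      using L2_measurable[OF L2_diff[OF t2 w2]] by measurable
    show "AE x in Om L. norm ((cmod (truncate M (f x) - w n x))\<^sup>2) \<le> (2 * M)\<^sup>2" for n
    proof (rule AE_I2)
      fix x
      have "cmod (truncate M (f x) - w n x) \<le> M + M"
        by (intro order_trans[OF norm_triangle_ineq4] add_mono cmod_truncate_le M wM)
      then have "(cmod (truncate M (f x) - w n x))\<^sup>2 \<le> (2 * M)\<^sup>2" by (intro power_mono) auto
      then show "norm ((cmod (truncate M (f x) - w n x))\<^sup>2) \<le> (2 * M)\<^sup>2" by simp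
    qed
    have "(\<lambda>n. (cmod (truncate M (f x) - w n x))\<^sup>2) \<longlonglongrightarrow> 0" if x: "x \<in> {0<..<L}" "x \<notin> N" for x
    proof -
      obtain K :: nat where K: "1 \<le> K * min x (L - x)"
        using x reals_Archimedean3[of "min x (L - x)"] by (auto intro: less_imp_le)
      have "\<eta> n x = 1" if "K \<le> n" for n
      proof -
        have "real K * min x (L - x) \<le> n * min x (L - x)" using that x by (intro mult_right_mono) auto
        then show ?thesis using K by (simp add: \<eta>_def)
      qed
      then have c: "(\<lambda>n. \<eta> n x) \<longlonglongrightarrow> 1"
        by (intro tendsto_eventually) (auto simp: eventually_sequentially)
      have "(\<lambda>n. truncate M (g n x)) \<longlonglongrightarrow> truncate M (f x)"
        using lim[OF x(2)] x(1) truncate_continuous[OF M(1), of UNIV]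
        by (intro isCont_tendsto_compose[of "f x" "truncate M"]) (auto simp: continuous_on_eq_continuous_at)
      then have "(\<lambda>n. w n x) \<longlonglongrightarrow> of_real 1 * truncate M (f x)"
        unfolding w_def by (intro tendsto_mult tendsto_of_real c)
      then have "(\<lambda>n. (cmod (truncate M (f x) - w n x))\<^sup>2) \<longlonglongrightarrow> (cmod (truncate M (f x) - of_real 1 * truncate M (f x)))\<^sup>2"
        by (intro tendsto_intros)
      then show ?thesis by simp
    qed
    then have "AE x in lebesgue. x \<in> {0<..<L} \<longrightarrow> (\<lambda>n. (cmod (truncate M (f x) - w n x))\<^sup>2) \<longlonglongrightarrow> 0"
      using N by (intro AE_I'[of N]) (auto simp: negligible_iff_null_sets)
    then show "AE x in Om L. (\<lambda>n. (cmod (truncate M (f x) - w n x))\<^sup>2) \<longlonglongrightarrow> 0"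
      by (subst AE_restrict_space_iff) auto
  qed auto
  then have "\<forall>\<^sub>F n in sequentially. L2_sq L (\<lambda>x. truncate M (f x) - w n x) < e / 4"
    using assms(3) by (intro order_tendstoD) auto
  then obtain n where n: "L2_sq L (\<lambda>x. truncate M (f x) - w n x) < e / 4"
    by (auto dest: eventually_happens)
  have "L2_sq L (\<lambda>x. (f x - truncate M (f x)) + (truncate M (f x) - w n x)) < e"
    using L2_sq_add_le[OF L2_diff[OF assms(2) t2] L2_diff[OF t2 w2[of n]]] n M(2) by simp
  moreover have "w n 0 = 0" "w n L = 0" using assms(1) by (auto simp: w_def \<eta>_def)
  ultimately show ?thesis using cw by (intro exI[of _ "w n"]) auto
qed

section \<open>Trigonometric polynomials\<close>

text \<open>
  Trigonometric polynomials of period \<open>2 L\<close>, generated term by term: closure under sums and products then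
  follows by induction, with no regrouping of coefficients.
\<close>

inductive trig :: "real \<Rightarrow> (real \<Rightarrow> complex) \<Rightarrow> bool" for L where
  trig_zero: "trig L (\<lambda>x. 0)"
| trig_add_term: "trig L f \<Longrightarrow> trig L (\<lambda>x. f x + c * cis (of_int n * pi * x / L))"

lemma trig_term: "trig L (\<lambda>x. c * cis (of_int n * pi * x / L))"
  using trig_add_term[OF trig_zero, of L c n] by simp

lemma trig_const: "trig L (\<lambda>x. c)"
  using trig_term[of L c 0] by simp

lemma trig_add:
  assumes f: "trig L f" and g: "trig L g" shows "trig L (\<lambda>x. f x + g x)"
  using g
proof induction
  case (trig_add_term g c n)
  from trig.trig_add_term[OF this(2), of c n] show ?case by (simp add: add.assoc)
qed (use f in simp)

lemma trig_mult_term: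
  assumes "trig L f" shows "trig L (\<lambda>x. f x * (d * cis (of_int m * pi * x / L)))"
  using assms
proof induction
  case (trig_add_term g c n)
  have "(\<lambda>x. (g x + c * cis (of_int n * pi * x / L)) * (d * cis (of_int m * pi * x / L)))
    = (\<lambda>x. g x * (d * cis (of_int m * pi * x / L)) + (c * d) * cis (of_int (n + m) * pi * x / L))"
    by (auto simp: fun_eq_iff algebra_simps cis_mult add_divide_distrib)
  then show ?case using trig.trig_add_term[OF trig_add_term(2), of "c * d" "n + m"] by simp
qed (simp add: trig_zero)

lemma trig_mult:
  assumes f: "trig L f" and g: "trig L g" shows "trig L (\<lambda>x. f x * g x)"
  using g
proof induction
  case (trig_add_term g c n)
  from trig_add[OF this(2) trig_mult_term[OF f]] show ?case by (simp add: distrib_left)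
qed (simp add: trig_zero)

lemma trig_imp_sum:
  assumes "trig L P"
  shows "\<exists>F c. finite F \<and> (\<forall>x. P x = (\<Sum>n\<in>F. c n * cis (of_int n * pi * x / L)))"
  using assms
proof induction
  case trig_zero
  show ?case by (intro exI[of _ "{}"]) auto
next
  case (trig_add_term f d n)
  then obtain F c where F: "finite F" "\<And>x. f x = (\<Sum>n\<in>F. c n * cis (of_int n * pi * x / L))" by blast
  define c0 where "c0 k = (if k \<in> F then c k else 0)" for k
  have "f x = (\<Sum>k\<in>insert n F. c0 k * cis (of_int k * pi * x / L))" for x
    unfolding F(2) c0_def using F(1) by (intro sum.mono_neutral_cong_left) auto
  then have "f x + d * cis (of_int n * pi * x / L)
      = (\<Sum>k\<in>insert n F. (c0 k + (if k = n then d else 0)) * cis (of_int k * pi * x / L))" for x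
    using F(1) by (simp add: distrib_right sum.distrib if_distrib[of "\<lambda>y. y * _"] sum.delta cong: if_cong)
  then show ?case using F(1) by (intro exI[of _ "insert n F"]) auto
qed

text \<open>
  A real-linear function of a point on the unit circle is a combination of the point and its inverse. The sign in
  \<open>- cis (\<pi> x / L)\<close> makes the circle start at \<open>1\<close> for \<open>x = -L\<close>.
\<close>

lemma trig_real_polynomial:
  assumes "real_polynomial_function p"
  shows "trig L (\<lambda>x. complex_of_real (p (- cis (pi * x / L))))"
  using assms
proof induction
  case (linear f)
  interpret bounded_linear f by fact
  have f: "f z = Re z * f 1 + Im z * f \<i>" for z
  proof -
    have "f z = f (Re z *\<^sub>R 1 + Im z *\<^sub>R \<i>)" by (rule arg_cong[of _ _ f]) (simp add: complex_eq_iff)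
    then show ?thesis by (simp only: add scaleR) simp
  qed
  let ?a = "- (f 1 - \<i> * f \<i>) / 2" and ?b = "- (f 1 + \<i> * f \<i>) / 2"
  have "complex_of_real (f (- cis (pi * x / L)))
      = ?a * cis (of_int 1 * pi * x / L) + ?b * cis (of_int (-1) * pi * x / L)" for x
    by (subst f) (simp add: complex_eq_iff algebra_simps, simp add: diff_divide_distrib add_divide_distrib)
  then show ?case using trig_add[OF trig_term trig_term] by presburger
next
  case (add f g)
  then show ?case using trig_add by simp
next
  case (mult f g)
  then show ?case using trig_mult by simp
qed (rule trig_const)

lemma trig_polynomial:
  assumes "polynomial_function (p :: complex \<Rightarrow> complex)"
  shows "trig L (\<lambda>x. p (- cis (pi * x / L)))"
proof -
  have "real_polynomial_function (Re \<circ> p)" "real_polynomial_function (Im \<circ> p)"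
    using assms bounded_linear_Re bounded_linear_Im by (auto simp: polynomial_function_def)
  then have "trig L (\<lambda>x. complex_of_real ((Re \<circ> p) (- cis (pi * x / L))) + \<i> * complex_of_real ((Im \<circ> p) (- cis (pi * x / L))))"
    by (intro trig_add trig_mult trig_const trig_real_polynomial)
  then show ?thesis by (simp add: complex_eq[symmetric])
qed

text \<open>
  The interval with identified end points is a circle, on which \<open>w\<close> becomes a continuous function; the
  Stone-Weierstrass theorem approximates it by a polynomial in the coordinates of the circle.
\<close>

lemma trig_dense:
  fixes w :: "real \<Rightarrow> complex"
  assumes "0 < L" and w: "continuous_on {-L..L} w" "w (-L) = w L" and "0 < e"
  shows "\<exists>P. trig L P \<and> (\<forall>x\<in>{-L..L}. cmod (w x - P x) < e)"
proof -
  define p where "p t = w (L * (2 * t - 1))" for t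
  have "path p" unfolding path_def p_def
  proof (rule continuous_on_compose2[OF w(1)])
    show "(\<lambda>t. L * (2 * t - 1)) ` {0..1} \<subseteq> {-L..L}"
    proof clarify
      fix t :: real assume t: "t \<in> {0..1}"
      have "L * (2 * t - 1) \<le> L * 1" "L * (-1) \<le> L * (2 * t - 1)"
        using t assms(1) by (intro mult_left_mono; simp)+
      then show "L * (2 * t - 1) \<in> {-L..L}" by simp
    qed
  qed (intro continuous_intros)
  moreover have "pathfinish p = pathstart p" using w by (simp add: p_def pathfinish_def pathstart_def)
  \<comment> \<open>a loop induces a continuous map of the circle: the constant homotopy is a case of a fact on homotopies of loops\<close>
  ultimately have "homotopic_loops UNIV p p" by (simp add: homotopic_loops_refl)
  from homotopic_loops_imp_homotopic_circlemaps[OF this]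
  have "continuous_on (sphere 0 1) (p \<circ> (\<lambda>z. Arg2pi z / (2 * pi)))"
    by (auto dest: homotopic_with_imp_continuous)
  then obtain g where g: "polynomial_function g"
    "\<And>z. z \<in> sphere 0 1 \<Longrightarrow> cmod ((p \<circ> (\<lambda>z. Arg2pi z / (2 * pi))) z - g z) < e"
    using Stone_Weierstrass_polynomial_function[OF compact_sphere _ assms(4)] by metis
  have G: "(p \<circ> (\<lambda>z. Arg2pi z / (2 * pi))) (- cis (pi * x / L)) = w x" if x: "-L \<le> x" "x < L" for x
  proof -
    have "Arg2pi (- cis (pi * x / L)) = pi * (x / L + 1)"
    proof (rule Arg2pi_unique)
      show "of_real 1 * exp (\<i> * of_real (pi * (x / L + 1))) = - cis (pi * x / L)"
        unfolding cis_conv_exp[symmetric] by (simp add: distrib_left cis_mult[symmetric])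
      show "0 \<le> pi * (x / L + 1)" using x assms(1) by (intro mult_nonneg_nonneg) (auto simp: field_simps)
      have "pi * (x / L + 1) < pi * 2" using x assms(1) by (intro mult_strict_left_mono) (auto simp: field_simps)
      then show "pi * (x / L + 1) < 2 * pi" by simp
    qed simp
    moreover have "L * (2 * (pi * (x / L + 1) / (2 * pi)) - 1) = x" using assms(1) by (simp add: field_simps)
    ultimately show ?thesis by (simp only: p_def o_def)
  qed
  have "cmod (w x - g (- cis (pi * x / L))) < e" if x: "x \<in> {-L..L}" for x
  proof (cases "x = L")
    case True
    then show ?thesis using G[of "-L"] g(2)[of "- cis (pi * (-L) / L)"] assms(1) w(2)
      by (simp add: cis_cnj[symmetric])
  next
    case False
    then show ?thesis using G[of x] g(2)[of "- cis (pi * x / L)"] x by simp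
  qed
  then show ?thesis using trig_polynomial[OF g(1)] by blast
qed

section \<open>Weighted exponentials\<close>

text \<open>
  The common shape of the numbers \<open>\<theta>\<^sub>n\<close> in both cases: constant imaginary part and equally spaced real
  parts, \<open>\<sigma>\<close> being the offset \<open>0\<close> or \<open>1/2\<close>.
\<close>

definition freq :: "real \<Rightarrow> real \<Rightarrow> real \<Rightarrow> int \<Rightarrow> complex" where
  "freq L \<tau> \<sigma> n = \<i> * of_real \<tau> + of_real ((of_int n + \<sigma>) * pi / L)"

lemma exp_freq:
  "exp (\<i> * (freq L \<tau> \<sigma> n * of_real x))
    = of_real (exp (- \<tau> * x)) * cis (\<sigma> * pi * x / L) * cis (of_int n * pi * x / L)"
proof -
  have "\<i> * (freq L \<tau> \<sigma> n * of_real x)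
      = of_real (- \<tau> * x) + \<i> * of_real (\<sigma> * pi * x / L) + \<i> * of_real (of_int n * pi * x / L)"
    by (simp add: freq_def distrib_left distrib_right add_divide_distrib mult.assoc[symmetric])
  then show ?thesis by (simp only: exp_add cis_conv_exp exp_of_real)
qed

lemma cmod_exp_freq_sum:
  "cmod (\<Sum>n\<in>F. c n * exp (\<i> * (freq L \<tau> \<sigma> n * of_real x)))
    = exp (- \<tau> * x) * cmod (\<Sum>n\<in>F. c n * cis (of_int n * pi * x / L))"
proof -
  have "(\<Sum>n\<in>F. c n * exp (\<i> * (freq L \<tau> \<sigma> n * of_real x)))
      = (of_real (exp (- \<tau> * x)) * cis (\<sigma> * pi * x / L)) * (\<Sum>n\<in>F. c n * cis (of_int n * pi * x / L))"
    unfolding exp_freq sum_distrib_left by (intro sum.cong) (auto simp: ac_simps)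
  then show ?thesis by (simp add: norm_mult del: of_real_exp exp_of_real)
qed

text \<open>
  Adding the reflected exponential replaces the integral over \<open>(-L, L)\<close> by one over \<open>(0, L)\<close>.
\<close>

lemma integral_cis_symmetric:
  assumes "0 < L"
  shows "(LINT x|Om L. cis (of_int j * pi * x / L) + cis (- (of_int j * pi * x / L)))
      = (if j = 0 then 2 * of_real L else 0)"
proof -
  have r: "cis (of_int j * pi * x / L) + cis (- (of_int j * pi * x / L)) = of_real (2 * cos (of_int j * pi * x / L))" for x
    by (simp add: complex_eq_iff)
  have "(LINT x|Om L. 2 * cos (of_int j * pi * x / L)) = (if j = 0 then 2 * L else 0)"
  proof (cases "j = 0")
    case True
    then show ?thesis using integral_Om_const[of L 2] assms by simp
  next
    case False
    let ?F = "\<lambda>x. 2 * (L / (of_int j * pi)) * sin (of_int j * pi * x / L)"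
    have "(LINT x|Om L. 2 * cos (of_int j * pi * x / L)) = ?F L - ?F 0"
    proof (rule integral_Om_derivative)
      show "(?F has_vector_derivative 2 * cos (of_int j * pi * x / L)) (at x)" for x
        unfolding has_real_derivative_iff_has_vector_derivative[symmetric]
        using assms False by (auto intro!: derivative_eq_intros)
    qed (use assms in \<open>auto intro!: continuous_intros\<close>)
    also have "\<dots> = 0" using assms sin_int_times_real[of j] by (simp add: mult.commute)
    finally show ?thesis using False by simp
  qed
  then show ?thesis unfolding r integral_complex_of_real by (simp del: integral_mult_right_zero)
qed

lemma trig_Parseval:
  fixes c :: "int \<Rightarrow> complex"
  assumes "0 < L" "finite F"
  defines "P \<equiv> \<lambda>x. \<Sum>n\<in>F. c n * cis (of_int n * pi * x / L)"
  shows "(LINT x|Om L. (cmod (P x))\<^sup>2 + (cmod (P (- x)))\<^sup>2) = 2 * L * (\<Sum>n\<in>F. (cmod (c n))\<^sup>2)"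
proof -
  \<comment> \<open>expand the square; only the diagonal terms survive the integration\<close>
  have sq: "complex_of_real ((cmod (P x))\<^sup>2) = (\<Sum>n\<in>F. \<Sum>m\<in>F. c n * cnj (c m) * cis (of_int (n - m) * pi * x / L))" for x
    unfolding complex_norm_square P_def cnj_sum sum_product
    by (intro sum.cong refl)
       (auto simp: cis_cnj cis_mult left_diff_distrib diff_divide_distrib mult.assoc mult.left_commute)
  have "complex_of_real (LINT x|Om L. (cmod (P x))\<^sup>2 + (cmod (P (- x)))\<^sup>2)
      = (LINT x|Om L. complex_of_real ((cmod (P x))\<^sup>2) + complex_of_real ((cmod (P (- x)))\<^sup>2))"
    unfolding of_real_add[symmetric] by (rule integral_complex_of_real[symmetric])
  also have "\<dots> = (LINT x|Om L. (\<Sum>n\<in>F. \<Sum>m\<in>F. c n * cnj (c m) *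
      (cis (of_int (n - m) * pi * x / L) + cis (- (of_int (n - m) * pi * x / L)))))"
    unfolding sq by (simp add: sum.distrib[symmetric] distrib_left)
  also have "\<dots> = (\<Sum>n\<in>F. \<Sum>m\<in>F. c n * cnj (c m) *
      (LINT x|Om L. cis (of_int (n - m) * pi * x / L) + cis (- (of_int (n - m) * pi * x / L))))"
  proof -
    have i: "integrable (Om L) (\<lambda>x. d * (cis (of_int j * pi * x / L) + cis (- (of_int j * pi * x / L))))" for j d
      by (intro integrable_Om_continuous continuous_intros) (use assms in auto)
    show ?thesis
      by (subst Bochner_Integration.integral_sum, intro Bochner_Integration.integrable_sum i)
         (subst Bochner_Integration.integral_sum, intro i, rule sum.cong[OF refl], rule sum.cong[OF refl],
          rule integral_mult_right_zero)
  qed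
  also have "\<dots> = (\<Sum>n\<in>F. \<Sum>m\<in>F. if m = n then c n * cnj (c m) * (2 * of_real L) else 0)"
    unfolding integral_cis_symmetric[OF assms(1)] by (intro sum.cong) auto
  also have "\<dots> = (\<Sum>n\<in>F. c n * cnj (c n) * (2 * of_real L))"
    using assms(2) by (simp add: sum.delta')
  also have "\<dots> = complex_of_real (2 * L * (\<Sum>n\<in>F. (cmod (c n))\<^sup>2))"
    unfolding complex_norm_square[symmetric] of_real_mult of_real_sum sum_distrib_left
    by (intro sum.cong refl) (simp add: mult.commute)
  finally show ?thesis by (simp only: of_real_eq_iff)
qed

text \<open>
  The function \<open>S\<close> on \<open>(-L, L)\<close> carries the same information as its even and odd parts on \<open>(0, L)\<close>.
\<close>

lemma freq_cos_sin_sums: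
  fixes x L \<tau> \<sigma> :: real and c :: "int \<Rightarrow> complex" and F :: "int set"
  defines "S \<equiv> \<lambda>x::real. \<Sum>n\<in>F. c n * exp (\<i> * (freq L \<tau> \<sigma> n * of_real x))"
  shows "(\<Sum>n\<in>F. c n * cos (freq L \<tau> \<sigma> n * of_real x)) = (S x + S (- x)) / 2"
    and "(\<Sum>n\<in>F. c n * sin (freq L \<tau> \<sigma> n * of_real x)) = (S x - S (- x)) / (2 * \<i>)"
proof -
  show "(\<Sum>n\<in>F. c n * cos (freq L \<tau> \<sigma> n * of_real x)) = (S x + S (- x)) / 2"
    unfolding S_def sum.distrib[symmetric] sum_divide_distrib
    by (intro sum.cong refl) (simp add: cos_exp_eq distrib_left)
  show "(\<Sum>n\<in>F. c n * sin (freq L \<tau> \<sigma> n * of_real x)) = (S x - S (- x)) / (2 * \<i>)"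
    unfolding S_def sum_subtractf[symmetric] sum_divide_distrib
    by (intro sum.cong refl) (simp add: sin_exp_eq right_diff_distrib)
qed

lemma parallelogram_half:
  "(cmod ((z + w) / 2))\<^sup>2 + (cmod ((z - w) / (2 * \<i>)))\<^sup>2 = ((cmod z)\<^sup>2 + (cmod w)\<^sup>2) / 2"
  by (simp add: norm_divide norm_mult power_divide cmod_power2) (simp add: power2_eq_square field_simps)

lemma continuous_on_freq_sums:
  "continuous_on A (\<lambda>x. \<Sum>n\<in>F. c n * cos (freq L \<tau> \<sigma> n * of_real x))"
  "continuous_on A (\<lambda>x. \<Sum>n\<in>F. c n * sin (freq L \<tau> \<sigma> n * of_real x))"
  by (intro continuous_intros)+

text \<open>
  The squared moduli of \<open>f\<close> and \<open>g\<close> add up to the mean of those of the exponential sum at \<open>x\<close> and \<open>-x\<close>. Up to the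
  weight \<open>exp (\<mp> 2 \<tau> x)\<close>, which lies between \<open>exp (- 2 \<tau> L)\<close> and \<open>exp (2 \<tau> L)\<close>, this is the integrand of
  Parseval's identity.
\<close>

lemma freq_sums_Riesz:
  fixes L \<tau> \<sigma> :: real and c :: "int \<Rightarrow> complex"
  assumes "0 < L" "0 \<le> \<tau>" "finite F"
  defines "f \<equiv> \<lambda>x. \<Sum>n\<in>F. c n * cos (freq L \<tau> \<sigma> n * of_real x)"
    and "g \<equiv> \<lambda>x. \<Sum>n\<in>F. c n * sin (freq L \<tau> \<sigma> n * of_real x)"
  shows "exp (- 2 * \<tau> * L) * L * (\<Sum>n\<in>F. (cmod (c n))\<^sup>2) \<le> L2_sq L f + L2_sq L g"
    and "L2_sq L f + L2_sq L g \<le> exp (2 * \<tau> * L) * L * (\<Sum>n\<in>F. (cmod (c n))\<^sup>2)"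
proof -
  define P where "P x = (\<Sum>n\<in>F. c n * cis (of_int n * pi * x / L))" for x
  define Q where "Q x = (cmod (P x))\<^sup>2 + (cmod (P (- x)))\<^sup>2" for x
  have cQ: "continuous_on {0..L} Q" unfolding Q_def P_def by (intro continuous_intros) (use assms in auto)
  have fg2: "f \<in> L2 L" "g \<in> L2 L" unfolding f_def g_def by (intro L2_continuous continuous_on_freq_sums)+
  have iQ: "integrable (Om L) (\<lambda>x. b * (Q x / 2))" for b
    using integrable_Om_continuous[OF cQ] by simp
  have IQ: "(LINT x|Om L. b * (Q x / 2)) = b * L * (\<Sum>n\<in>F. (cmod (c n))\<^sup>2)" for b
    using trig_Parseval[OF assms(1,3), of c] by (simp add: Q_def P_def)
  have ifg: "integrable (Om L) (\<lambda>x. (cmod (f x))\<^sup>2 + (cmod (g x))\<^sup>2)"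
    using fg2 by (intro Bochner_Integration.integrable_add L2_square_integrable)
  have Ifg: "(LINT x|Om L. (cmod (f x))\<^sup>2 + (cmod (g x))\<^sup>2) = L2_sq L f + L2_sq L g"
    unfolding L2_sq_def using fg2 by (intro Bochner_Integration.integral_add L2_square_integrable)
  have pt: "(cmod (f x))\<^sup>2 + (cmod (g x))\<^sup>2
      = ((exp (- \<tau> * x))\<^sup>2 * (cmod (P x))\<^sup>2 + (exp (\<tau> * x))\<^sup>2 * (cmod (P (- x)))\<^sup>2) / 2" for x
    unfolding f_def g_def freq_cos_sin_sums parallelogram_half cmod_exp_freq_sum P_def power_mult_distrib
    by simp
  have bnd: "exp (- 2 * \<tau> * L) \<le> (exp y)\<^sup>2" "(exp y)\<^sup>2 \<le> exp (2 * \<tau> * L)" if "\<bar>y\<bar> \<le> \<tau> * L" for y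
  proof -
    have "- 2 * \<tau> * L \<le> 2 * y" "2 * y \<le> 2 * \<tau> * L" using that by linarith+
    then show "exp (- 2 * \<tau> * L) \<le> (exp y)\<^sup>2" "(exp y)\<^sup>2 \<le> exp (2 * \<tau> * L)"
      unfolding exp_double[symmetric] exp_le_cancel_iff .
  qed
  have yb: "\<bar>- \<tau> * x\<bar> \<le> \<tau> * L" "\<bar>\<tau> * x\<bar> \<le> \<tau> * L" if "x \<in> {0<..<L}" for x
    using that assms(2) by (auto simp: abs_mult intro: mult_left_mono)
  have lo: "exp (- 2 * \<tau> * L) * (Q x / 2) \<le> (cmod (f x))\<^sup>2 + (cmod (g x))\<^sup>2" if x: "x \<in> {0<..<L}" for x
  proof -
    have "exp (- 2 * \<tau> * L) * Q x \<le> (exp (- \<tau> * x))\<^sup>2 * (cmod (P x))\<^sup>2 + (exp (\<tau> * x))\<^sup>2 * (cmod (P (- x)))\<^sup>2"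
      unfolding Q_def distrib_left using bnd(1)[OF yb(1)[OF x]] bnd(1)[OF yb(2)[OF x]]
      by (intro add_mono mult_right_mono) auto
    then show ?thesis unfolding pt by simp
  qed
  have up: "(cmod (f x))\<^sup>2 + (cmod (g x))\<^sup>2 \<le> exp (2 * \<tau> * L) * (Q x / 2)" if x: "x \<in> {0<..<L}" for x
  proof -
    have "(exp (- \<tau> * x))\<^sup>2 * (cmod (P x))\<^sup>2 + (exp (\<tau> * x))\<^sup>2 * (cmod (P (- x)))\<^sup>2 \<le> exp (2 * \<tau> * L) * Q x"
      unfolding Q_def distrib_left using bnd(2)[OF yb(1)[OF x]] bnd(2)[OF yb(2)[OF x]]
      by (intro add_mono mult_right_mono) auto
    then show ?thesis unfolding pt by simp
  qed
  show "exp (- 2 * \<tau> * L) * L * (\<Sum>n\<in>F. (cmod (c n))\<^sup>2) \<le> L2_sq L f + L2_sq L g"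
    unfolding Ifg[symmetric] IQ[symmetric] by (rule integral_mono[OF iQ ifg]) (use lo in auto)
  show "L2_sq L f + L2_sq L g \<le> exp (2 * \<tau> * L) * L * (\<Sum>n\<in>F. (cmod (c n))\<^sup>2)"
    unfolding Ifg[symmetric] IQ[symmetric] by (rule integral_mono[OF ifg iQ]) (use up in auto)
qed

text \<open>
  The pair \<open>(f, g)\<close> is unfolded to one function \<open>W\<close> on \<open>[-L, L]\<close> with even part \<open>f\<close> and odd part \<open>\<i> g\<close>. The zeros
  of \<open>f\<close> and \<open>g\<close> at \<open>0\<close> and \<open>L\<close> make \<open>W\<close> continuous and periodic, even after division by the common
  factor of the exponentials \<open>exp (\<i> \<theta>\<^sub>n x)\<close>, so that a trigonometric polynomial is uniformly close to the quotient.
\<close>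

lemma freq_sums_approx_continuous:
  assumes "0 < L" "0 \<le> \<tau>" "0 < e"
    and f: "continuous_on UNIV f" "f 0 = 0" "f L = 0" and g: "continuous_on UNIV g" "g 0 = 0" "g L = 0"
  shows "\<exists>F c. finite F \<and> (\<forall>x\<in>{0..L}.
     cmod (f x - (\<Sum>n\<in>F. c n * cos (freq L \<tau> \<sigma> n * of_real x))) \<le> e \<and>
     cmod (g x - (\<Sum>n\<in>F. c n * sin (freq L \<tau> \<sigma> n * of_real x))) \<le> e)"
proof -
  define W where "W x = (if 0 \<le> x then f x + \<i> * g x else f (- x) - \<i> * g (- x))" for x
  define w where "w x = W x * (of_real (exp (\<tau> * x)) * cis (- (\<sigma> * pi * x / L)))" for x
  have cW: "continuous_on UNIV W"
  proof -
    have "continuous_on ({0..} \<union> {..0}) (\<lambda>x. if 0 \<le> x then f x + \<i> * g x else f (- x) - \<i> * g (- x))"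
      using f g by (intro continuous_on_If continuous_intros continuous_on_compose2[OF f(1)]
         continuous_on_compose2[OF g(1)] continuous_on_subset[OF f(1)] continuous_on_subset[OF g(1)]) auto
    moreover have "{0::real..} \<union> {..0} = UNIV" by auto
    ultimately show ?thesis unfolding W_def by simp
  qed
  have "continuous_on {-L..L} w" unfolding w_def
    by (intro continuous_intros continuous_on_subset[OF cW]) (use assms in auto)
  moreover have "w (- L) = w L" using f g assms(1) by (simp add: w_def W_def)
  ultimately obtain P where P: "trig L P" "\<And>x. x \<in> {-L..L} \<Longrightarrow> cmod (w x - P x) < exp (- \<tau> * L) * e"
    using trig_dense[OF assms(1), of w "exp (- \<tau> * L) * e"] assms(3) by auto
  from trig_imp_sum[OF P(1)] obtain F c
    where F: "finite F" "\<And>x. P x = (\<Sum>n\<in>F. c n * cis (of_int n * pi * x / L))" by blast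
  define S where "S x = (\<Sum>n\<in>F. c n * exp (\<i> * (freq L \<tau> \<sigma> n * of_real x)))" for x :: real
  have S: "S x = (of_real (exp (- \<tau> * x)) * cis (\<sigma> * pi * x / L)) * P x" for x
    unfolding S_def F(2) exp_freq sum_distrib_left by (intro sum.cong) (auto simp: ac_simps)
  have "W x = (of_real (exp (- \<tau> * x)) * cis (\<sigma> * pi * x / L)) * w x" for x
  proof -
    have "exp (- \<tau> * x) * exp (\<tau> * x) = 1" by (simp add: exp_add[symmetric])
    then have "complex_of_real (exp (- \<tau> * x)) * of_real (exp (\<tau> * x)) = 1"
      unfolding of_real_mult[symmetric] by simp
    moreover have "cis (\<sigma> * pi * x / L) * cis (- (\<sigma> * pi * x / L)) = 1" by (simp add: cis_mult)
    ultimately show ?thesis by (simp only: w_def) algebra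
  qed
  then have WS: "W x - S x = (of_real (exp (- \<tau> * x)) * cis (\<sigma> * pi * x / L)) * (w x - P x)" for x
    by (simp only: S right_diff_distrib)
  have err: "cmod (W x - S x) \<le> e" if x: "x \<in> {-L..L}" for x
  proof -
    have "cmod (W x - S x) = exp (- \<tau> * x) * cmod (w x - P x)"
      unfolding WS by (simp add: norm_mult del: of_real_exp exp_of_real)
    also have "\<dots> \<le> exp (\<tau> * L) * (exp (- \<tau> * L) * e)"
    proof (rule mult_mono)
      have "\<tau> * (- x) \<le> \<tau> * L" using x assms(2) by (intro mult_left_mono) auto
      then show "exp (- \<tau> * x) \<le> exp (\<tau> * L)" by simp
    qed (use P(2)[OF x] in auto)
    also have "\<dots> = e" by (simp add: mult.assoc[symmetric] exp_add[symmetric])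
    finally show ?thesis .
  qed
  show ?thesis
  proof (intro exI[of _ F] exI[of _ c] conjI ballI F(1))
    fix x assume x: "x \<in> {0..L}"
    have half: "(cmod (W x - S x) + cmod (W (- x) - S (- x))) / 2 \<le> e"
      using add_mono[OF err[of x] err[of "- x"]] x by simp
    have "f x = (W x + W (- x)) / 2" using x f g by (auto simp: W_def)
    then have "f x - (S x + S (- x)) / 2 = ((W x - S x) + (W (- x) - S (- x))) / 2" by (simp add: field_simps)
    then have "cmod (f x - (S x + S (- x)) / 2) \<le> (cmod (W x - S x) + cmod (W (- x) - S (- x))) / 2"
      using norm_triangle_ineq[of "W x - S x" "W (- x) - S (- x)"] by (simp only: norm_divide) simp
    then show "cmod (f x - (\<Sum>n\<in>F. c n * cos (freq L \<tau> \<sigma> n * of_real x))) \<le> e"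
      unfolding freq_cos_sin_sums S_def[symmetric] using half by (rule order_trans)
    have "g x = (W x - W (- x)) / (2 * \<i>)" using x f g by (auto simp: W_def field_simps)
    then have "g x - (S x - S (- x)) / (2 * \<i>) = ((W x - S x) - (W (- x) - S (- x))) / (2 * \<i>)"
      by (simp only: diff_divide_distrib[symmetric]) (simp add: algebra_simps)
    then have "cmod (g x - (S x - S (- x)) / (2 * \<i>)) \<le> (cmod (W x - S x) + cmod (W (- x) - S (- x))) / 2"
      using norm_triangle_ineq4[of "W x - S x" "W (- x) - S (- x)"] by (simp only: norm_divide norm_mult) simp
    then show "cmod (g x - (\<Sum>n\<in>F. c n * sin (freq L \<tau> \<sigma> n * of_real x))) \<le> e"
      unfolding freq_cos_sin_sums S_def[symmetric] using half by (rule order_trans)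
  qed
qed

lemma freq_sums_dense:
  assumes "0 < L" "0 \<le> \<tau>" "0 < e" "f \<in> L2 L" "g \<in> L2 L"
  shows "\<exists>F c. finite F \<and>
     L2_sq L (\<lambda>x. f x - (\<Sum>n\<in>F. c n * cos (freq L \<tau> \<sigma> n * of_real x))) < e \<and>
     L2_sq L (\<lambda>x. g x - (\<Sum>n\<in>F. c n * sin (freq L \<tau> \<sigma> n * of_real x))) < e"
proof -
  obtain f' where f': "continuous_on UNIV f'" "f' 0 = 0" "f' L = 0" "L2_sq L (\<lambda>x. f x - f' x) < e / 4"
    using continuous_dense_L2[OF assms(1,4), of "e / 4"] assms(3) by auto
  obtain g' where g': "continuous_on UNIV g'" "g' 0 = 0" "g' L = 0" "L2_sq L (\<lambda>x. g x - g' x) < e / 4"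
    using continuous_dense_L2[OF assms(1,5), of "e / 4"] assms(3) by auto
  \<comment> \<open>a uniform error \<open>d\<close> on \<open>(0, L)\<close> costs \<open>L d\<^sup>2 = e / 4\<close> in the squared norm\<close>
  define d where "d = sqrt (e / (4 * L))"
  have d: "0 < d" "L * d\<^sup>2 = e / 4" using assms by (auto simp: d_def)
  from freq_sums_approx_continuous[OF assms(1,2) d(1) f'(1-3) g'(1-3), of \<sigma>]
  obtain F c where Fc: "finite F \<and> (\<forall>x\<in>{0..L}.
     cmod (f' x - (\<Sum>n\<in>F. c n * cos (freq L \<tau> \<sigma> n * of_real x))) \<le> d \<and>
     cmod (g' x - (\<Sum>n\<in>F. c n * sin (freq L \<tau> \<sigma> n * of_real x))) \<le> d)"
    by (elim exE) (rule that)
  have *: "L2_sq L (\<lambda>x. h x - S x) < e"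
    if "h \<in> L2 L" "continuous_on UNIV h'" "L2_sq L (\<lambda>x. h x - h' x) < e / 4" "continuous_on UNIV S"
      "\<And>x. x \<in> {0..L} \<Longrightarrow> cmod (h' x - S x) \<le> d" for h h' S
  proof -
    have h': "h' \<in> L2 L" "S \<in> L2 L" using that by (auto intro!: L2_continuous elim: continuous_on_subset)
    have "L2_sq L (\<lambda>x. (h x - h' x) + (h' x - S x)) \<le> 2 * L2_sq L (\<lambda>x. h x - h' x) + 2 * L2_sq L (\<lambda>x. h' x - S x)"
      by (intro L2_sq_add_le L2_diff that h')
    moreover have "L2_sq L (\<lambda>x. h' x - S x) \<le> L * d\<^sup>2"
      by (intro L2_sq_bounded L2_diff h') (use that assms in auto)
    ultimately show ?thesis using that(3) d(2) by simp
  qed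
  show ?thesis
  proof (intro exI[of _ F] exI[of _ c] conjI)
    show "L2_sq L (\<lambda>x. f x - (\<Sum>n\<in>F. c n * cos (freq L \<tau> \<sigma> n * of_real x))) < e"
      by (rule *[OF assms(4) f'(1,4) continuous_on_freq_sums(1)]) (use Fc in simp)
    show "L2_sq L (\<lambda>x. g x - (\<Sum>n\<in>F. c n * sin (freq L \<tau> \<sigma> n * of_real x))) < e"
      by (rule *[OF assms(5) g'(1,4) continuous_on_freq_sums(2)]) (use Fc in simp)
  qed (use Fc in simp)
qed

section \<open>One damped string\<close>

lemma weak_derivative_zero_imp_zero:
  assumes "has_weak_derivative L u p" "continuous_on {0..L} u" "u 0 = 0"
    and p: "\<And>x. x \<in> {0..L} \<Longrightarrow> p x = 0" and x: "x \<in> {0..L}"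
  shows "u x = 0"
proof (rule has_derivative_zero_unique_strong_interval[of "{0, L}" 0 L u])
  fix y assume "y \<in> {0..L} - {0, L}"
  then have y: "y \<in> {0<..<L}" by auto
  have "continuous_on {0..L} p \<longleftrightarrow> continuous_on {0..L} (\<lambda>x. 0 :: complex)"
    by (rule continuous_on_cong) (use p in auto)
  then have "continuous_on {0..L} p" by simp
  from weak_derivative_imp_derivative[OF assms(1,2) this y]
  have "(u has_vector_derivative 0) (at y)" using p[of y] y by simp
  then show "(u has_derivative (\<lambda>h. 0)) (at y within {0..L})"
    by (auto simp: has_vector_derivative_def intro: has_derivative_at_withinI)
qed (use assms in auto)

lemma H2_classical:
  assumes "0 < L" and u: "\<And>x. (u has_vector_derivative p x) (at x)"
    and p: "\<And>x. (p has_vector_derivative q x) (at x)" and q: "continuous_on UNIV q"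
  shows "u \<in> H2 L" "wderiv L u L = p L" "AE x in Om L. wderiv L (wderiv L u) x = q x"
proof -
  have cp: "continuous_on UNIV p" and cu: "continuous_on UNIV u"
    using u p by (meson continuous_at_imp_continuous_on has_vector_derivative_continuous)+
  have c: "continuous_on {0..L} u" "continuous_on {0..L} p"
    using cp cu by (auto elim: continuous_on_subset)
  have wu: "has_weak_derivative L u p" by (rule weak_derivative_classical[OF assms(1) u cp])
  have wp: "has_weak_derivative L p q" by (rule weak_derivative_classical[OF assms(1) p q])
  have e: "wderiv L u x = p x" if "x \<in> {0..L}" for x
    by (rule wderiv_eq[OF assms(1) c(1) wu c(2) that])
  have cw: "continuous_on {0..L} (wderiv L u)" by (rule wderiv_continuous[OF wu c(2)])
  have ww: "has_weak_derivative L (wderiv L u) q"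
    by (rule weak_derivative_cong[OF wp]) (simp add: e)
  show "u \<in> H2 L" using c cw wu ww by (auto simp: H2_def H1_def)
  show "wderiv L u L = p L" using e assms(1) by simp
  show "AE x in Om L. wderiv L (wderiv L u) x = q x" by (rule wderiv_AE[OF cw ww])
qed

text \<open>
  A single layer. The parameter \<open>c\<close> is the wave speed and \<open>a = \<gamma> c\<close> the normalized damping, so that
  \<open>a = 1\<close> is the critical value at which outgoing waves are absorbed completely.
\<close>

locale damped_string =
  fixes L c a \<tau> \<sigma> :: real
  assumes L: "0 < L" and c: "0 < c" and a: "0 < a" "a \<noteq> 1"
    and \<tau>_eq: "\<tau> = ln \<bar>(a + 1) / (a - 1)\<bar> / (2 * L)"
    and \<sigma>_eq: "\<sigma> = (if 1 < a then 0 else 1 / 2)"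
begin

abbreviation \<theta> :: "int \<Rightarrow> complex" where "\<theta> \<equiv> freq L \<tau> \<sigma>"

definition mode :: "int \<Rightarrow> real \<Rightarrow> complex" where
  "mode n x = inverse (\<theta> n) * sin (\<theta> n * of_real x)"

text \<open>
  Since \<open>\<bar>a - 1\<bar> < a + 1\<close> for positive \<open>a\<close>. In particular no frequency vanishes.
\<close>

lemma \<tau>_pos: "0 < \<tau>"
proof -
  have "1 < \<bar>(a + 1) / (a - 1)\<bar>" using a by (simp add: abs_divide less_divide_eq)
  then show ?thesis using L by (simp add: \<tau>_eq)
qed

lemma \<theta>_nonzero: "\<theta> n \<noteq> 0"
proof
  assume "\<theta> n = 0"
  then have "Im (\<theta> n) = 0" by simp
  then show False using \<tau>_pos by (simp add: freq_def)
qed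

text \<open>
  The modulus of the right-hand side fixes \<open>\<tau>\<close>, its sign fixes \<open>\<sigma>\<close>; the integer \<open>n\<close> counts the branches of
  the logarithm, which gives the converse \<open>exp_eq_imp_\<theta>\<close>.
\<close>

lemma exp_\<theta>: "exp (2 * \<i> * \<theta> n * of_real L) = of_real ((a - 1) / (a + 1))"
proof -
  have "exp (2 * \<i> * \<theta> n * of_real L) = exp (\<i> * (\<theta> n * of_real (2 * L)))" by (simp add: ac_simps)
  also have "\<dots> = of_real (exp (- \<tau> * (2 * L))) * cis (2 * pi * \<sigma>) * cis (2 * pi * of_int n)"
    unfolding exp_freq using L by (simp add: ac_simps)
  also have "exp (- \<tau> * (2 * L)) = \<bar>(a - 1) / (a + 1)\<bar>"
  proof -
    have "- \<tau> * (2 * L) = - ln \<bar>(a + 1) / (a - 1)\<bar>" using L by (simp add: \<tau>_eq)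
    then show ?thesis using a by (simp add: exp_minus abs_divide)
  qed
  also have "of_real \<bar>(a - 1) / (a + 1)\<bar> * cis (2 * pi * \<sigma>) * cis (2 * pi * of_int n)
      = complex_of_real ((a - 1) / (a + 1))"
  proof (cases "1 < a")
    case True
    then show ?thesis by (simp add: \<sigma>_eq cis_multiple_2pi)
  next
    case False
    then have "\<bar>(a - 1) / (a + 1)\<bar> = - ((a - 1) / (a + 1))"
      using a False by (simp add: abs_divide minus_divide_left)
    then show ?thesis using False by (simp only: \<sigma>_eq) (simp add: cis_multiple_2pi)
  qed
  finally show ?thesis .
qed

lemma exp_eq_imp_\<theta>:
  assumes "exp (2 * \<mu> * of_real L) = of_real ((a - 1) / (a + 1))"
  shows "\<exists>n. \<mu> = \<i> * \<theta> n"
proof -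
  have "exp (2 * \<mu> * of_real L) = exp (2 * \<i> * \<theta> 0 * of_real L)" unfolding assms exp_\<theta> ..
  then obtain n :: int where n: "2 * \<mu> * of_real L = 2 * \<i> * \<theta> 0 * of_real L + (of_int (2 * n) * pi) * \<i>"
    unfolding exp_eq by blast
  have "2 * of_real L * \<mu> = 2 * of_real L * (\<i> * \<theta> n)"
    using n L by (simp add: freq_def field_simps)
  then have "\<mu> = \<i> * \<theta> n" using L by simp
  then show ?thesis ..
qed

text \<open>
  The damping condition at \<open>L\<close>, obtained from the characteristic equation by division by
  \<open>exp (\<i> \<theta>\<^sub>n L)\<close>.
\<close>

lemma cos_sin_boundary: "cos (\<theta> n * of_real L) + \<i> * of_real a * sin (\<theta> n * of_real L) = 0"
proof -
  define w where "w = exp (\<i> * (\<theta> n * of_real L))"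
  have w0: "w \<noteq> 0" by (simp add: w_def)
  have "w * w = exp (2 * \<i> * \<theta> n * of_real L)"
    by (simp add: w_def exp_add[symmetric] ac_simps)
  then have ww: "w * w = of_real ((a - 1) / (a + 1))" by (simp only: exp_\<theta>)
  have "of_real (a + 1) * (w * w) = complex_of_real (a - 1)"
    unfolding ww of_real_mult[symmetric] using a by simp
  then have e: "w * w * (1 + of_real a) + (1 - of_real a) = 0" by (simp add: algebra_simps)
  have "cos (\<theta> n * of_real L) + \<i> * of_real a * sin (\<theta> n * of_real L)
      = (w + inverse w) / 2 + of_real a * (w - inverse w) / 2"
  proof -
    have "exp (- (\<i> * (\<theta> n * of_real L))) = inverse w" by (simp add: w_def exp_minus)
    then have "cos (\<theta> n * of_real L) = (w + inverse w) / 2" "sin (\<theta> n * of_real L) = (w - inverse w) / (2 * \<i>)"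
      by (simp_all only: cos_exp_eq sin_exp_eq w_def)
    moreover have "\<i> * of_real a * (d / (2 * \<i>)) = of_real a * d / 2" for d :: complex
      by (simp add: complex_eq_iff)
    ultimately show ?thesis by (simp only: add_divide_distrib)
  qed
  also have "\<dots> = (w * w * (1 + of_real a) + (1 - of_real a)) / (2 * w)"
    using w0 by (simp add: field_simps)
  finally show ?thesis using e by simp
qed

lemma mode_derivative: "(mode n has_vector_derivative cos (\<theta> n * of_real x)) (at x)"
proof -
  have d: "((\<lambda>x. \<theta> n * of_real x) has_vector_derivative \<theta> n) (at x)"
    by (auto intro!: derivative_eq_intros simp: has_vector_derivative_def scaleR_conv_of_real)
  have "((\<lambda>x. sin (\<theta> n * of_real x)) has_vector_derivative \<theta> n * cos (\<theta> n * of_real x)) (at x)"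
    using field_vector_diff_chain_at[OF d DERIV_sin] by (simp add: o_def)
  then have "((\<lambda>x. inverse (\<theta> n) * sin (\<theta> n * of_real x)) has_vector_derivative
      inverse (\<theta> n) * (\<theta> n * cos (\<theta> n * of_real x))) (at x)"
    by (rule has_vector_derivative_mult_right)
  then show ?thesis using \<theta>_nonzero unfolding mode_def[abs_def] by (simp add: mult.assoc[symmetric])
qed

lemma cos_derivative:
  "((\<lambda>x. cos (\<theta> n * of_real x)) has_vector_derivative - (\<theta> n)\<^sup>2 * mode n x) (at x)"
proof -
  have d: "((\<lambda>x. \<theta> n * of_real x) has_vector_derivative \<theta> n) (at x)"
    by (auto intro!: derivative_eq_intros simp: has_vector_derivative_def scaleR_conv_of_real)
  have "((\<lambda>x. cos (\<theta> n * of_real x)) has_vector_derivative \<theta> n * - sin (\<theta> n * of_real x)) (at x)"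
    using field_vector_diff_chain_at[OF d DERIV_cos] by (simp add: o_def)
  moreover have "\<theta> n * - sin (\<theta> n * of_real x) = - (\<theta> n)\<^sup>2 * mode n x"
    using \<theta>_nonzero[of n] by (simp add: mode_def power2_eq_square field_simps)
  ultimately show ?thesis by simp
qed

lemma continuous_on_mode: "continuous_on S (mode n)"
  unfolding mode_def by (intro continuous_intros)

lemma weak_derivative_mode: "has_weak_derivative L (mode n) (\<lambda>x. cos (\<theta> n * of_real x))"
  by (rule weak_derivative_classical[OF L mode_derivative]) (intro continuous_intros)

text \<open>
  If the mode vanished, so would its derivative \<open>cos (\<theta>\<^sub>n x)\<close>, which is \<open>1\<close> at \<open>0\<close>.
\<close>

lemma mode_not_AE_zero: "\<not> (AE x in Om L. mode n x = 0)"
proof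
  assume z: "AE x in Om L. mode n x = 0"
  have "mode n x = 0" if "x \<in> {0..L}" for x
    by (rule continuous_AE_eq[OF L continuous_on_mode _ z that]) simp
  then have "has_weak_derivative L (mode n) (\<lambda>x. 0)"
    by (intro weak_derivative_cong[OF weak_derivative_classical[OF L, of "\<lambda>x. 0" "\<lambda>x. 0"]]) auto
  from weak_derivative_unique[OF continuous_on_mode weak_derivative_mode this]
  have "AE x in Om L. cos (\<theta> n * of_real x) = 0" .
  moreover have "continuous_on {0..L} (\<lambda>x. cos (\<theta> n * of_real x))" by (intro continuous_intros)
  ultimately have "cos (\<theta> n * of_real 0) = 0"
    using continuous_AE_eq[OF L, of "\<lambda>x. cos (\<theta> n * of_real x)" "\<lambda>x. 0" 0] L by simp
  then show False by simp
qed

text \<open>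
  Solving the equation from \<open>x = 0\<close> leaves \<open>u'(0)\<close> as the only free constant. If it is zero, \<open>u\<close> vanishes and \<open>A = 0\<close>
  is taken; otherwise the damping condition is the characteristic equation for \<open>\<mu> = l / c\<close>. The value \<open>\<mu> = 0\<close> is covered by
  the same computation, as it would require \<open>(a - 1) / (a + 1) = 1\<close>.
\<close>

lemma eigenfunction_classification:
  assumes u: "u \<in> H2 L" "u \<in> H1_star L" and v: "v \<in> H1_star L"
    and bc: "wderiv L u L + of_real (a / c) * v L = 0"
    and vu: "AE x in Om L. v x = l * u x"
    and ode: "AE x in Om L. of_real (c\<^sup>2) * wderiv L (wderiv L u) x = l * v x"
  shows "\<exists>A n. (A \<noteq> 0 \<longrightarrow> l = \<i> * of_real c * \<theta> n) \<and>
     (\<forall>x\<in>{0..L}. u x = A * mode n x \<and> v x = l * (A * mode n x))"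
proof -
  define p where "p = wderiv L u"
  define \<mu> where "\<mu> = l / of_real c"
  have l: "l = \<mu> * of_real c" using c by (simp add: \<mu>_def)
  have cu: "continuous_on {0..L} u" and cv: "continuous_on {0..L} v" and cp: "continuous_on {0..L} p"
    and u0: "u 0 = 0"
    using u v by (auto simp: H2_def H1_def H1_star_def p_def)
  have wu: "has_weak_derivative L u p"
    unfolding p_def using u by (auto simp: H2_def H1_def intro: wderiv_weak_derivative)
  have wp: "has_weak_derivative L p (wderiv L p)"
    unfolding p_def using u by (auto simp: H2_def H1_def intro: wderiv_weak_derivative)
  have veq: "v x = l * u x" if "x \<in> {0..L}" for x
    by (rule continuous_AE_eq[OF L cv _ vu that]) (intro continuous_intros cu)
  have q: "AE x in Om L. wderiv L p x = \<mu>\<^sup>2 * u x"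
    using vu ode
  proof eventually_elim
    case (elim x)
    have "(of_real c)\<^sup>2 * wderiv L p x = (of_real c)\<^sup>2 * (\<mu>\<^sup>2 * u x)"
      using elim by (simp add: p_def l power2_eq_square mult.assoc)
    then show ?case using c by simp
  qed
  have plus: "p x + \<mu> * u x = p 0 * exp (\<mu> * of_real x)" if "x \<in> {0..L}" for x
    using second_order_ode[OF L wu cu wp cp q that] u0 by simp
  have minus: "p x - \<mu> * u x = p 0 * exp (- \<mu> * of_real x)" if "x \<in> {0..L}" for x
    using second_order_ode[OF L wu cu wp cp, of "- \<mu>"] q u0 that by simp
  have p2: "2 * p x = p 0 * (exp (\<mu> * of_real x) + exp (- \<mu> * of_real x))"
    and u2: "2 * (\<mu> * u x) = p 0 * (exp (\<mu> * of_real x) - exp (- \<mu> * of_real x))" if "x \<in> {0..L}" for x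
    using plus[OF that] minus[OF that] by algebra+
  show ?thesis
  proof (cases "p 0 = 0")
    case True
    have p0: "p x = 0" if "x \<in> {0..L}" for x using p2[OF that] True by simp
    have "u x = 0" if "x \<in> {0..L}" for x
      by (rule weak_derivative_zero_imp_zero[OF wu cu u0 p0 that])
    then show ?thesis using veq by (intro exI[of _ 0] exI[of _ 0]) auto
  next
    case False
    define w where "w = exp (\<mu> * of_real L)"
    have w: "exp (- \<mu> * of_real L) = inverse w" "w \<noteq> 0" by (simp_all add: w_def exp_minus)
    have LL: "L \<in> {0..L}" using L by auto
    have "p L + of_real a * (\<mu> * u L) = 0"
      using bc veq[OF LL] c by (simp add: p_def l)
    then have "2 * p L + of_real a * (2 * (\<mu> * u L)) = 0" by algebra
    then have "p 0 * ((w + inverse w) + of_real a * (w - inverse w)) = 0"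
      unfolding p2[OF LL] u2[OF LL] w(1) w_def[symmetric] by algebra
    then have "(w + inverse w) + of_real a * (w - inverse w) = 0" using False by simp
    then have "w * ((w + inverse w) + of_real a * (w - inverse w)) = 0" by simp
    then have "w * w * (of_real a + 1) = of_real a - 1"
      using w(2) by (simp add: algebra_simps)
    moreover have "complex_of_real a + 1 \<noteq> 0"
      using a by (metis add_pos_pos of_real_1 of_real_add of_real_eq_0_iff zero_less_one less_irrefl)
    ultimately have "w * w = of_real ((a - 1) / (a + 1))" by (simp add: field_simps)
    moreover have "w * w = exp (2 * \<mu> * of_real L)" by (simp add: w_def exp_add[symmetric] ac_simps)
    ultimately obtain n where n: "\<mu> = \<i> * \<theta> n" using exp_eq_imp_\<theta> by metis
    have "u x = p 0 * mode n x" if x: "x \<in> {0..L}" for x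
    proof -
      have "2 * \<i> * \<theta> n * u x = p 0 * (2 * \<i> * sin (\<theta> n * of_real x))"
      proof -
        have "2 * \<i> * sin (\<theta> n * of_real x) = exp (\<i> * (\<theta> n * of_real x)) - exp (- (\<i> * (\<theta> n * of_real x)))"
          unfolding sin_exp_eq by (subst times_divide_eq_right, rule nonzero_mult_div_cancel_left) simp
        then show ?thesis using u2[OF x] by (simp add: n mult.assoc)
      qed
      then show ?thesis using \<theta>_nonzero[of n] by (simp add: mode_def field_simps)
    qed
    then show ?thesis using veq by (intro exI[of _ "p 0"] exI[of _ n]) (auto simp: l n)
  qed
qed

text \<open>
  A combination of eigenfunctions: its two components \<open>modes_u\<close> and \<open>modes_v\<close>, the derivative \<open>modes_cos\<close> of the
  first, and the sum \<open>modes_sin\<close> of which the second is the multiple by \<open>\<i> c\<close>.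
\<close>

definition modes_u :: "int set \<Rightarrow> (int \<Rightarrow> complex) \<Rightarrow> real \<Rightarrow> complex" where
  "modes_u F b x = (\<Sum>n\<in>F. b n * mode n x)"

definition modes_v :: "int set \<Rightarrow> (int \<Rightarrow> complex) \<Rightarrow> real \<Rightarrow> complex" where
  "modes_v F b x = (\<Sum>n\<in>F. b n * (\<i> * of_real c * \<theta> n * mode n x))"

definition modes_cos :: "int set \<Rightarrow> (int \<Rightarrow> complex) \<Rightarrow> real \<Rightarrow> complex" where
  "modes_cos F b x = (\<Sum>n\<in>F. b n * cos (\<theta> n * of_real x))"

definition modes_sin :: "int set \<Rightarrow> (int \<Rightarrow> complex) \<Rightarrow> real \<Rightarrow> complex" where
  "modes_sin F b x = (\<Sum>n\<in>F. b n * sin (\<theta> n * of_real x))"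

lemma modes_v_eq: "modes_v F b = (\<lambda>x. \<i> * of_real c * modes_sin F b x)"
  unfolding modes_v_def modes_sin_def mode_def sum_distrib_left
  using \<theta>_nonzero by (intro ext sum.cong) auto

lemma modes_u_zero: "modes_u F b 0 = 0"
  by (simp add: modes_u_def mode_def)

lemma continuous_on_modes:
  "continuous_on S (modes_u F b)" "continuous_on S (modes_v F b)"
  "continuous_on S (modes_cos F b)" "continuous_on S (modes_sin F b)"
  unfolding modes_u_def modes_v_def modes_cos_def modes_sin_def
  by (intro continuous_intros continuous_on_mode)+

lemma weak_derivative_modes:
  assumes "finite F" shows "has_weak_derivative L (modes_u F b) (modes_cos F b)"
  unfolding modes_u_def[abs_def] modes_cos_def[abs_def]
  by (intro weak_derivative_sum assms weak_derivative_scale weak_derivative_mode)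

definition low :: real where "low = min 1 (c\<^sup>2) * (exp (- 2 * \<tau> * L) * L)"

definition high :: real where "high = (1 + L\<^sup>2 + c\<^sup>2) * (exp (2 * \<tau> * L) * L)"

lemma low_high_pos: "0 < low" "0 < high"
  using L c by (auto simp: low_def high_def intro!: mult_pos_pos add_pos_nonneg)

text \<open>
  The bounds of \<open>freq_sums_Riesz\<close> for the cosine and sine sums; the factor \<open>\<i> c\<close> of the sine sum and the Poincare
  inequality for the first component account for the remaining constants.
\<close>

lemma modes_Riesz:
  fixes b :: "int \<Rightarrow> complex"
  assumes F: "finite F"
  defines "N \<equiv> L2_sq L (modes_u F b) + L2_sq L (modes_cos F b) + L2_sq L (modes_v F b)"
  shows "low * (\<Sum>n\<in>F. (cmod (b n))\<^sup>2) \<le> N" "N \<le> high * (\<Sum>n\<in>F. (cmod (b n))\<^sup>2)"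
proof -
  define f where "f = L2_sq L (modes_cos F b)"
  define g where "g = L2_sq L (modes_sin F b)"
  define s where "s = (\<Sum>n\<in>F. (cmod (b n))\<^sup>2)"
  have nn: "0 \<le> f" "0 \<le> g" "0 \<le> L2_sq L (modes_u F b)" by (simp_all add: f_def g_def L2_sq_nonneg)
  have v: "L2_sq L (modes_v F b) = c\<^sup>2 * g"
    unfolding modes_v_eq L2_sq_scale g_def by (simp add: norm_mult)
  have pu: "L2_sq L (modes_u F b) \<le> L\<^sup>2 * f" unfolding f_def
    by (rule Poincare[OF L weak_derivative_modes[OF F] continuous_on_modes(1) modes_u_zero])
  have R: "exp (- 2 * \<tau> * L) * L * s \<le> f + g" "f + g \<le> exp (2 * \<tau> * L) * L * s"
    using freq_sums_Riesz[OF L less_imp_le[OF \<tau>_pos] F, of b \<sigma>]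
    unfolding f_def g_def s_def modes_cos_def[abs_def] modes_sin_def[abs_def] .
  have "low * s = min 1 (c\<^sup>2) * (exp (- 2 * \<tau> * L) * L * s)" by (simp add: low_def)
  also have "\<dots> \<le> min 1 (c\<^sup>2) * (f + g)" using R(1) by (rule mult_left_mono) simp
  also have "\<dots> \<le> 1 * f + c\<^sup>2 * g" unfolding distrib_left using nn by (intro add_mono mult_right_mono) auto
  also have "\<dots> \<le> N" using nn by (simp add: N_def v f_def[symmetric])
  finally show "low * (\<Sum>n\<in>F. (cmod (b n))\<^sup>2) \<le> N" by (simp add: s_def)
  have "N \<le> L\<^sup>2 * f + f + c\<^sup>2 * g" using pu by (simp add: N_def v f_def)
  also have "\<dots> \<le> (1 + L\<^sup>2 + c\<^sup>2) * (f + g)" using nn by (simp add: algebra_simps)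
  also have "\<dots> \<le> (1 + L\<^sup>2 + c\<^sup>2) * (exp (2 * \<tau> * L) * L * s)" using R(2) by (rule mult_left_mono) simp
  also have "\<dots> = high * s" by (simp add: high_def)
  finally show "N \<le> high * (\<Sum>n\<in>F. (cmod (b n))\<^sup>2)" by (simp add: s_def)
qed

text \<open>
  It suffices to approximate \<open>g\<close> and \<open>v / (\<i> c)\<close> simultaneously by the cosine and sine sums: the error of \<open>u\<close> itself
  vanishes at \<open>0\<close> and is controlled by that of its derivative.
\<close>

lemma modes_dense:
  assumes u: "continuous_on {0..L} u" "u 0 = 0" "has_weak_derivative L u g" and v: "v \<in> L2 L" and "0 < e"
  shows "\<exists>F b. finite F \<and> L2_sq L (\<lambda>x. u x - modes_u F b x) + L2_sq L (\<lambda>x. g x - modes_cos F b x)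
     + L2_sq L (\<lambda>x. v x - modes_v F b x) < e"
proof -
  define K where "K = L\<^sup>2 + 1 + c\<^sup>2"
  define d where "d = e / K"
  have K: "0 < K" unfolding K_def using zero_le_power2[of L] zero_le_power2[of c] by linarith
  then have d: "0 < d" using \<open>0 < e\<close> by (simp add: d_def)
  define ic where "ic = \<i> * complex_of_real c"
  have ic: "ic \<noteq> 0" "cmod ic = c" using c by (auto simp: ic_def norm_mult)
  have g: "g \<in> L2 L" using u by (simp add: has_weak_derivative_def)
  from freq_sums_dense[OF L less_imp_le[OF \<tau>_pos] d g L2_scale[OF v, of "inverse ic"], of \<sigma>]
  obtain F b where F: "finite F" and f1: "L2_sq L (\<lambda>x. g x - modes_cos F b x) < d"
    and g1: "L2_sq L (\<lambda>x. inverse ic * v x - modes_sin F b x) < d"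
    unfolding modes_cos_def[symmetric] modes_sin_def[symmetric] by blast
  have "(\<lambda>x. v x - modes_v F b x) = (\<lambda>x. ic * (inverse ic * v x - modes_sin F b x))"
    using ic(1) by (simp add: modes_v_eq ic_def[symmetric] right_diff_distrib mult.assoc[symmetric])
  then have v1: "L2_sq L (\<lambda>x. v x - modes_v F b x) = c\<^sup>2 * L2_sq L (\<lambda>x. inverse ic * v x - modes_sin F b x)"
    by (simp only: L2_sq_scale ic(2))
  have "has_weak_derivative L (\<lambda>x. u x + (-1) * modes_u F b x) (\<lambda>x. g x + (-1) * modes_cos F b x)"
    by (intro weak_derivative_add weak_derivative_scale u weak_derivative_modes F)
  then have w: "has_weak_derivative L (\<lambda>x. u x - modes_u F b x) (\<lambda>x. g x - modes_cos F b x)" by simp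
  have u1: "L2_sq L (\<lambda>x. u x - modes_u F b x) \<le> L\<^sup>2 * L2_sq L (\<lambda>x. g x - modes_cos F b x)"
    by (rule Poincare[OF L w]) (auto intro!: continuous_intros u continuous_on_modes simp: u modes_u_zero)
  have "L2_sq L (\<lambda>x. u x - modes_u F b x) + L2_sq L (\<lambda>x. g x - modes_cos F b x) + L2_sq L (\<lambda>x. v x - modes_v F b x)
      \<le> (L\<^sup>2 + 1) * L2_sq L (\<lambda>x. g x - modes_cos F b x) + c\<^sup>2 * L2_sq L (\<lambda>x. inverse ic * v x - modes_sin F b x)"
    using u1 v1 by (simp add: algebra_simps)
  also have "\<dots> < (L\<^sup>2 + 1) * d + c\<^sup>2 * d"
  proof (intro add_strict_mono mult_strict_left_mono)
    show "0 < L\<^sup>2 + 1" by (intro add_nonneg_pos) auto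
  qed (use f1 g1 c in auto)
  also have "\<dots> = K * d" by (simp add: K_def algebra_simps)
  also have "\<dots> = e" using K by (simp add: d_def)
  finally show ?thesis using F by blast
qed

end

section \<open>The decoupled system\<close>

lemma finite_odd_layers: "finite (odd_layers m)"
  by (rule finite_subset[of _ "{..2 * m + 1}"]) (auto simp: odd_layers_def)

lemma odd_layers_nonempty: "odd_layers m \<noteq> {}"
  by (auto simp: odd_layers_def intro: exI[of _ 1])

lemma fst_sum_state_scale: "fst (\<Sum>i\<in>F. state_scale (c i) (z i)) k x = (\<Sum>i\<in>F. c i * fst (z i) k x)"
  and snd_sum_state_scale: "snd (\<Sum>i\<in>F. state_scale (c i) (z i)) k x = (\<Sum>i\<in>F. c i * snd (z i) k x)"
  by (induction F rule: infinite_finite_induct) (auto simp: state_scale_def)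

lemma sum_layer:
  assumes "finite F" and g: "\<And>j n. j \<noteq> k \<Longrightarrow> g (j, n) = 0"
  shows "(\<Sum>i\<in>F. g i) = (\<Sum>n\<in>Pair k -` F. (g (k, n) :: complex))"
proof -
  have "(\<Sum>i\<in>F. g i) = (\<Sum>i\<in>Pair k ` (Pair k -` F). g i)"
  proof (rule sum.mono_neutral_right[OF assms(1)])
    show "\<forall>i\<in>F - Pair k ` (Pair k -` F). g i = 0"
    proof
      fix i assume i: "i \<in> F - Pair k ` (Pair k -` F)"
      then have "fst i \<noteq> k" by (cases i) auto
      then show "g i = 0" using g[of "fst i" "snd i"] by simp
    qed
  qed auto
  also have "\<dots> = (\<Sum>n\<in>Pair k -` F. g (k, n))"
    by (subst sum.reindex) (auto simp: inj_on_def)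
  finally show ?thesis .
qed

lemma sum_layers:
  fixes g :: "nat \<times> int \<Rightarrow> real"
  assumes "finite F" "F \<subseteq> odd_layers m \<times> UNIV"
  shows "(\<Sum>i\<in>F. g i) = (\<Sum>k\<in>odd_layers m. \<Sum>n\<in>Pair k -` F. g (k, n))"
proof -
  have f: "finite (Pair k -` F)" for k using assms(1) by (intro finite_vimageI) (auto simp: inj_on_def)
  have "F = Sigma (odd_layers m) (\<lambda>k. Pair k -` F)" using assms(2) by auto
  then have "(\<Sum>i\<in>F. g i) = (\<Sum>i\<in>Sigma (odd_layers m) (\<lambda>k. Pair k -` F). g i)" by simp
  also have "\<dots> = (\<Sum>k\<in>odd_layers m. \<Sum>n\<in>Pair k -` F. g (k, n))"
    by (subst sum.Sigma) (auto simp: finite_odd_layers f)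
  finally show ?thesis .
qed

text \<open>
  The norm may be computed with any weak derivatives, since they agree almost everywhere with the chosen ones.
\<close>

lemma state_norm_squared:
  assumes "\<And>k. k \<in> odd_layers m \<Longrightarrow> continuous_on {0..L} (fst z k)"
    and "\<And>k. k \<in> odd_layers m \<Longrightarrow> has_weak_derivative L (fst z k) (g k)"
  shows "(ip_norm (state_inner m L) z)\<^sup>2
    = (\<Sum>k\<in>odd_layers m. L2_sq L (fst z k) + L2_sq L (g k) + L2_sq L (snd z k))"
proof -
  have "state_inner m L z z = (\<Sum>k\<in>odd_layers m. of_real (L2_sq L (fst z k) + L2_sq L (g k) + L2_sq L (snd z k)))"
    unfolding state_inner_def
    by (intro sum.cong refl) (simp add: H1_inner_self[OF assms] L2_inner_self)
  then have "Re (state_inner m L z z) = (\<Sum>k\<in>odd_layers m. L2_sq L (fst z k) + L2_sq L (g k) + L2_sq L (snd z k))"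
    by simp
  moreover have "0 \<le> (\<Sum>k\<in>odd_layers m. L2_sq L (fst z k) + L2_sq L (g k) + L2_sq L (snd z k))"
    by (intro sum_nonneg add_nonneg_nonneg L2_sq_nonneg)
  ultimately show ?thesis by (simp add: ip_norm_def)
qed

locale layered_system =
  fixes m :: nat and L :: real and \<rho> E \<gamma> :: "nat \<Rightarrow> real"
  assumes L_pos: "0 < L"
    and pos: "\<And>k. k \<in> odd_layers m \<Longrightarrow> 0 < \<rho> k \<and> 0 < E k \<and> 0 < \<gamma> k"
    and noncritical: "\<And>k. k \<in> odd_layers m \<Longrightarrow> \<gamma> k \<noteq> sqrt (\<rho> k / E k)"
begin

definition speed :: "nat \<Rightarrow> real" where "speed k = sqrt (E k / \<rho> k)"

definition decay :: "nat \<Rightarrow> real" where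
  "decay k = ln \<bar>(\<gamma> k * speed k + 1) / (\<gamma> k * speed k - 1)\<bar> / (2 * L)"

definition shift :: "nat \<Rightarrow> real" where "shift k = (if 1 < \<gamma> k * speed k then 0 else 1 / 2)"

abbreviation "layer_mode k \<equiv> damped_string.mode L (decay k) (shift k)"
abbreviation "layer_u k \<equiv> damped_string.modes_u L (decay k) (shift k)"
abbreviation "layer_v k \<equiv> damped_string.modes_v L (speed k) (decay k) (shift k)"
abbreviation "layer_cos k \<equiv> damped_string.modes_cos L (decay k) (shift k)"

lemma speed_pos: "k \<in> odd_layers m \<Longrightarrow> 0 < speed k"
  using pos by (simp add: speed_def)

lemma speed_squared: "k \<in> odd_layers m \<Longrightarrow> (speed k)\<^sup>2 = E k / \<rho> k"
  using pos[of k] by (simp add: speed_def)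

lemma impedance: 
  assumes "k \<in> odd_layers m"
  shows "1 < \<gamma> k * speed k \<longleftrightarrow> sqrt (\<rho> k / E k) < \<gamma> k" "\<gamma> k * speed k \<noteq> 1"
proof -
  have e: "speed k = inverse (sqrt (\<rho> k / E k))" "0 < sqrt (\<rho> k / E k)"
    using pos[OF assms] by (auto simp: speed_def real_sqrt_divide)
  show "1 < \<gamma> k * speed k \<longleftrightarrow> sqrt (\<rho> k / E k) < \<gamma> k"
    unfolding e(1) using e(2) by (simp only: divide_inverse[symmetric] less_divide_eq_1_pos)
  show "\<gamma> k * speed k \<noteq> 1"
    unfolding e(1) using e(2) noncritical[OF assms] by (simp only: divide_inverse[symmetric] divide_eq_1_iff) simp
qed

lemma layer_string: "k \<in> odd_layers m \<Longrightarrow> damped_string L (speed k) (\<gamma> k * speed k) (decay k) (shift k)"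
  using L_pos pos[of k] speed_pos[of k] impedance(2)[of k]
  by unfold_locales (auto simp: decay_def shift_def)

lemma theta_eq: "k \<in> odd_layers m \<Longrightarrow> theta L \<rho> E \<gamma> k n = freq L (decay k) (shift k) n"
  using impedance(1)[of k] by (simp add: theta_def freq_def decay_def shift_def speed_def[symmetric])

lemma lam_eq: "k \<in> odd_layers m \<Longrightarrow> lam L \<rho> E \<gamma> k n = \<i> * of_real (speed k) * freq L (decay k) (shift k) n"
  by (simp add: lam_def theta_eq speed_def)

lemma e_vec_eq: "k \<in> odd_layers m \<Longrightarrow> e_vec L \<rho> E \<gamma> k n = (\<lambda>j x. if j = k then layer_mode k n x else 0)"
  unfolding e_vec_def theta_eq damped_string.mode_def[OF layer_string] by (rule refl)

lemma eigenstate_eq: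
  assumes "k \<in> odd_layers m"
  shows "fst (eigenstate L \<rho> E \<gamma> k n) = (\<lambda>j x. if j = k then layer_mode k n x else 0)"
    and "snd (eigenstate L \<rho> E \<gamma> k n) = (\<lambda>j x. if j = k then
       \<i> * of_real (speed k) * freq L (decay k) (shift k) n * layer_mode k n x else 0)"
  using assms by (auto simp: eigenstate_def e_vec_eq lam_eq fun_eq_iff)

text \<open>
  The component for layer \<open>k\<close> only sees the index pairs whose first entry is \<open>k\<close>: this is the decoupling of the
  system.
\<close>

lemma eigenstate_sum:
  assumes F: "finite F" "F \<subseteq> odd_layers m \<times> UNIV" and k: "k \<in> odd_layers m"
  shows "fst (\<Sum>i\<in>F. state_scale (b i) (case i of (k, n) \<Rightarrow> eigenstate L \<rho> E \<gamma> k n)) k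
      = layer_u k (Pair k -` F) (\<lambda>n. b (k, n))"
    and "snd (\<Sum>i\<in>F. state_scale (b i) (case i of (k, n) \<Rightarrow> eigenstate L \<rho> E \<gamma> k n)) k
      = layer_v k (Pair k -` F) (\<lambda>n. b (k, n))"
proof -
  have "(\<Sum>i\<in>F. b i * fst (case i of (k, n) \<Rightarrow> eigenstate L \<rho> E \<gamma> k n) k x)
      = (\<Sum>i\<in>F. if fst i = k then b i * layer_mode k (snd i) x else 0)" for x
    using F(2) by (intro sum.cong refl) (auto simp: eigenstate_eq)
  then show "fst (\<Sum>i\<in>F. state_scale (b i) (case i of (k, n) \<Rightarrow> eigenstate L \<rho> E \<gamma> k n)) k
      = layer_u k (Pair k -` F) (\<lambda>n. b (k, n))"
    unfolding damped_string.modes_u_def[OF layer_string[OF k], abs_def] fst_sum_state_scale[abs_def]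
    by (intro ext) (simp add: sum_layer[OF F(1), of k])
  have "(\<Sum>i\<in>F. b i * snd (case i of (k, n) \<Rightarrow> eigenstate L \<rho> E \<gamma> k n) k x)
      = (\<Sum>i\<in>F. if fst i = k then b i * (\<i> * of_real (speed k) * freq L (decay k) (shift k) (snd i) * layer_mode k (snd i) x) else 0)" for x
    using F(2) by (intro sum.cong refl) (auto simp: eigenstate_eq)
  then show "snd (\<Sum>i\<in>F. state_scale (b i) (case i of (k, n) \<Rightarrow> eigenstate L \<rho> E \<gamma> k n)) k
      = layer_v k (Pair k -` F) (\<lambda>n. b (k, n))"
    unfolding damped_string.modes_v_def[OF layer_string[OF k], abs_def] snd_sum_state_scale[abs_def]
    by (intro ext) (simp add: sum_layer[OF F(1), of k])
qed

lemma eigenstate_eigenfunction: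
  assumes k: "k \<in> odd_layers m"
  shows "system_eigenfunction m L \<rho> E \<gamma> (lam L \<rho> E \<gamma> k n) (eigenstate L \<rho> E \<gamma> k n)"
proof -
  interpret damped_string L "speed k" "\<gamma> k * speed k" "decay k" "shift k" by (rule layer_string[OF k])
  define u where "u j x = (if j = k then mode n x else 0)" for j :: nat and x
  define p where "p j x = (if j = k then cos (\<theta> n * of_real x) else 0)" for j :: nat and x :: real
  define q where "q j x = - (\<theta> n)\<^sup>2 * u j x" for j x
  define l where "l = \<i> * of_real (speed k) * \<theta> n"
  have z: "eigenstate L \<rho> E \<gamma> k n = (u, \<lambda>j x. l * u j x)"
    by (simp add: eigenstate_def e_vec_eq[OF k] lam_eq[OF k] l_def u_def[abs_def])
  have l: "lam L \<rho> E \<gamma> k n = l" by (simp add: lam_eq[OF k] l_def)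
  have du: "(u j has_vector_derivative p j x) (at x)" for j x
    using mode_derivative[of n x] by (cases "j = k") (auto simp: u_def[abs_def] p_def[abs_def])
  have dp: "(p j has_vector_derivative q j x) (at x)" for j x
    using cos_derivative[of n x] by (cases "j = k") (auto simp: u_def[abs_def] p_def[abs_def] q_def[abs_def])
  have cu: "continuous_on S (u j)" for S j
    using continuous_on_mode by (cases "j = k") (auto simp: u_def[abs_def])
  have cq: "continuous_on UNIV (q j)" for j unfolding q_def by (intro continuous_intros cu)
  note H = H2_classical[OF L du dp cq]
  have us: "u j \<in> H1_star L" for j
    using H(1)[of j] by (auto simp: H2_def H1_star_def u_def mode_def)
  have wl: "(\<lambda>x. l * u j x) \<in> H1_star L" for j
    using us[of j] by (auto simp: H1_star_def H1_def intro!: continuous_intros dest: weak_derivative_scale)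
  have bc: "p j L + of_real (\<gamma> j) * (l * u j L) = 0" for j
  proof (cases "j = k")
    case True
    have "l * u k L = \<i> * of_real (speed k) * sin (\<theta> n * of_real L)"
      using \<theta>_nonzero[of n] by (simp add: u_def l_def mode_def)
    then have "p k L + of_real (\<gamma> k) * (l * u k L)
        = cos (\<theta> n * of_real L) + \<i> * of_real (\<gamma> k * speed k) * sin (\<theta> n * of_real L)"
      by (simp add: p_def)
    then show ?thesis using cos_sin_boundary[of n] True by simp
  qed (simp add: p_def u_def)
  have "(u, \<lambda>j x. l * u j x) \<in> system_domain m L \<gamma>"
    by (simp add: system_domain_def H us wl bc)
  moreover have "\<not> state_eq m L (u, \<lambda>j x. l * u j x) 0"
  proof
    assume "state_eq m L (u, \<lambda>j x. l * u j x) 0"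
    then have "AE x in Om L. u k x = 0 \<and> l * u k x = 0" using k by (auto simp: state_eq_def)
    then have "AE x in Om L. mode n x = 0" by eventually_elim (simp add: u_def)
    then show False using mode_not_AE_zero by blast
  qed
  moreover have "state_eq m L (system_op L \<rho> E (u, \<lambda>j x. l * u j x)) (state_scale l (u, \<lambda>j x. l * u j x))"
    unfolding state_eq_def
  proof
    fix j assume j: "j \<in> odd_layers m"
    have "of_real (E j / \<rho> j) * q j x = l * (l * u j x)" for x
    proof (cases "j = k")
      case True
      have "complex_of_real (E j / \<rho> j) = (of_real (speed k))\<^sup>2"
        using speed_squared[OF k] True by (simp only: of_real_power[symmetric])
      moreover have "\<i> * \<i> = - 1" by simp
      ultimately show ?thesis unfolding q_def l_def by algebra
    qed (simp add: q_def u_def)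
    then show "AE x in Om L. fst (system_op L \<rho> E (u, \<lambda>j x. l * u j x)) j x = fst (state_scale l (u, \<lambda>j x. l * u j x)) j x \<and>
        snd (system_op L \<rho> E (u, \<lambda>j x. l * u j x)) j x = snd (state_scale l (u, \<lambda>j x. l * u j x)) j x"
      using H(3)[of j] by (auto simp: system_op_def state_scale_def elim!: eventually_mono)
  qed
  ultimately show ?thesis unfolding system_eigenfunction_def z l by blast
qed

lemma eigenfunction_components:
  assumes z: "system_eigenfunction m L \<rho> E \<gamma> l z" and k: "k \<in> odd_layers m"
  shows "\<exists>A n. (A \<noteq> 0 \<longrightarrow> lam L \<rho> E \<gamma> k n = l) \<and>
     (\<forall>x\<in>{0..L}. fst z k x = A * layer_mode k n x \<and> snd z k x = l * (A * layer_mode k n x))"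
proof -
  interpret damped_string L "speed k" "\<gamma> k * speed k" "decay k" "shift k" by (rule layer_string[OF k])
  obtain u v where uv: "z = (u, v)" by (cases z)
  have D: "u k \<in> H2 L" "u k \<in> H1_star L" "v k \<in> H1_star L" "wderiv L (u k) L + of_real (\<gamma> k) * v k L = 0"
    using z k by (auto simp: system_eigenfunction_def system_domain_def uv)
  have eq: "AE x in Om L. v k x = l * u k x \<and> of_real (E k / \<rho> k) * wderiv L (wderiv L (u k)) x = l * v k x"
    using z k by (simp add: system_eigenfunction_def state_eq_def system_op_def state_scale_def uv)
  have "\<exists>A n. (A \<noteq> 0 \<longrightarrow> l = \<i> * of_real (speed k) * \<theta> n) \<and>
     (\<forall>x\<in>{0..L}. u k x = A * mode n x \<and> v k x = l * (A * mode n x))"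
  proof (rule eigenfunction_classification[OF D(1-3)])
    show "wderiv L (u k) L + of_real (\<gamma> k * speed k / speed k) * v k L = 0"
      using D(4) speed_pos[OF k] by simp
    show "AE x in Om L. v k x = l * u k x" using eq by (auto elim: eventually_mono)
    show "AE x in Om L. of_real ((speed k)\<^sup>2) * wderiv L (wderiv L (u k)) x = l * v k x"
      unfolding speed_squared[OF k] using eq by (auto elim: eventually_mono)
  qed
  then show ?thesis by (auto simp: uv lam_eq[OF k])
qed

text \<open>
  Every layer in which the eigenfunction is nonzero contributes one mode of that layer, and one mode suffices. Several
  layers may share the eigenvalue, whence a combination.
\<close>

lemma eigenfunction_span:
  assumes z: "system_eigenfunction m L \<rho> E \<gamma> l z"
  shows "\<exists>F c. finite F \<and> F \<subseteq> {(k, n). k \<in> odd_layers m \<and> lam L \<rho> E \<gamma> k n = l} \<and>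
     state_eq m L z (\<Sum>i\<in>F. state_scale (c i) (case i of (k, n) \<Rightarrow> eigenstate L \<rho> E \<gamma> k n))"
proof -
  obtain A N where AN: "\<And>k. k \<in> odd_layers m \<Longrightarrow> (A k \<noteq> 0 \<longrightarrow> lam L \<rho> E \<gamma> k (N k) = l) \<and>
     (\<forall>x\<in>{0..L}. fst z k x = A k * layer_mode k (N k) x \<and> snd z k x = l * (A k * layer_mode k (N k) x))"
    using eigenfunction_components[OF z] by metis
  define F where "F = (\<lambda>k. (k, N k)) ` {k \<in> odd_layers m. A k \<noteq> 0}"
  have F: "finite F" "F \<subseteq> {(k, n). k \<in> odd_layers m \<and> lam L \<rho> E \<gamma> k n = l}"
    using AN finite_odd_layers by (auto simp: F_def)
  then have F': "F \<subseteq> odd_layers m \<times> UNIV" by auto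
  have "state_eq m L z (\<Sum>i\<in>F. state_scale (A (fst i)) (case i of (k, n) \<Rightarrow> eigenstate L \<rho> E \<gamma> k n))"
    unfolding state_eq_def
  proof
    fix k assume k: "k \<in> odd_layers m"
    interpret damped_string L "speed k" "\<gamma> k * speed k" "decay k" "shift k" by (rule layer_string[OF k])
    have v: "Pair k -` F = (if A k = 0 then {} else {N k})" using k by (auto simp: F_def)
    have "A k * (\<i> * of_real (speed k) * \<theta> (N k)) = A k * l" using AN[OF k] lam_eq[OF k] by auto
    then have s: "modes_v (Pair k -` F) (\<lambda>n. A k) x = l * (A k * mode (N k) x)" for x
      by (cases "A k = 0") (simp_all add: modes_v_def v)
    have f: "modes_u (Pair k -` F) (\<lambda>n. A k) x = A k * mode (N k) x" for x
      by (simp add: modes_u_def v)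
    show "AE x in Om L. fst z k x = fst (\<Sum>i\<in>F. state_scale (A (fst i)) (case i of (k, n) \<Rightarrow> eigenstate L \<rho> E \<gamma> k n)) k x \<and>
        snd z k x = snd (\<Sum>i\<in>F. state_scale (A (fst i)) (case i of (k, n) \<Rightarrow> eigenstate L \<rho> E \<gamma> k n)) k x"
      unfolding eigenstate_sum[OF F(1) F' k] fst_conv s f
      by (rule AE_I2) (use AN[OF k] in auto)
  qed
  then show ?thesis using F by (intro exI[of _ F] exI[of _ "\<lambda>i. A (fst i)"]) auto
qed

lemma eigenvalues: "{l. system_eigenvalue m L \<rho> E \<gamma> l} = {lam L \<rho> E \<gamma> k n | k n. k \<in> odd_layers m}"
proof (intro set_eqI iffI)
  fix l assume "l \<in> {l. system_eigenvalue m L \<rho> E \<gamma> l}"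
  then obtain z where z: "system_eigenfunction m L \<rho> E \<gamma> l z" by (auto simp: system_eigenvalue_def)
  obtain F c where F: "F \<subseteq> {(k, n). k \<in> odd_layers m \<and> lam L \<rho> E \<gamma> k n = l}"
    "state_eq m L z (\<Sum>i\<in>F. state_scale (c i) (case i of (k, n) \<Rightarrow> eigenstate L \<rho> E \<gamma> k n))"
    using eigenfunction_span[OF z] by blast
  have "F \<noteq> {}" using F(2) z by (auto simp: system_eigenfunction_def)
  then show "l \<in> {lam L \<rho> E \<gamma> k n | k n. k \<in> odd_layers m}" using F(1) by blast
next
  fix l assume "l \<in> {lam L \<rho> E \<gamma> k n | k n. k \<in> odd_layers m}"
  then obtain k n where kn: "k \<in> odd_layers m" "l = lam L \<rho> E \<gamma> k n" by blast
  have "system_eigenfunction m L \<rho> E \<gamma> l (eigenstate L \<rho> E \<gamma> k n)"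
    unfolding kn(2) by (rule eigenstate_eigenfunction[OF kn(1)])
  then show "l \<in> {l. system_eigenvalue m L \<rho> E \<gamma> l}"
    unfolding mem_Collect_eq system_eigenvalue_def ..
qed

lemma eigenstate_in_space:
  assumes "k \<in> odd_layers m" shows "eigenstate L \<rho> E \<gamma> k n \<in> state_space m L"
proof -
  obtain u v where uv: "eigenstate L \<rho> E \<gamma> k n = (u, v)" by (rule prod.exhaust)
  have "(u, v) \<in> system_domain m L \<gamma>"
    using eigenstate_eigenfunction[OF assms, of n] by (simp add: system_eigenfunction_def uv)
  moreover have "H1_star L \<subseteq> L2 L" by (auto simp: H1_star_def H1_def intro: L2_continuous)
  ultimately show ?thesis unfolding uv system_domain_def state_space_def mem_Collect_eq prod.case by blast
qed

text \<open>
  Each layer is approximated up to an equal share of \<open>\<epsilon>\<^sup>2\<close>.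
\<close>

lemma eigenstates_dense:
  assumes z: "z \<in> state_space m L" and "0 < \<epsilon>"
  shows "\<exists>F c. finite F \<and> F \<subseteq> odd_layers m \<times> UNIV \<and>
    ip_norm (state_inner m L) (z - (\<Sum>i\<in>F. state_scale (c i) (case i of (k, n) \<Rightarrow> eigenstate L \<rho> E \<gamma> k n))) < \<epsilon>"
proof -
  obtain u v where uv: "z = (u, v)" by (cases z)
  have U: "continuous_on {0..L} (u k)" "u k 0 = 0" "\<exists>g. has_weak_derivative L (u k) g" "v k \<in> L2 L"
    if "k \<in> odd_layers m" for k
    using z that by (auto simp: uv state_space_def H1_star_def H1_def)
  obtain g where g: "\<And>k. k \<in> odd_layers m \<Longrightarrow> has_weak_derivative L (u k) (g k)" using U(3) by metis
  define e where "e = \<epsilon>\<^sup>2 / card (odd_layers m)"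
  have card: "0 < card (odd_layers m)" using finite_odd_layers odd_layers_nonempty by (simp add: card_gt_0_iff)
  then have e: "0 < e" using \<open>0 < \<epsilon>\<close> by (simp add: e_def)
  define near where "near k G b \<longleftrightarrow> finite G \<and> L2_sq L (\<lambda>x. u k x - layer_u k G b x)
      + L2_sq L (\<lambda>x. g k x - layer_cos k G b x) + L2_sq L (\<lambda>x. v k x - layer_v k G b x) < e" for k G b
  have "\<exists>G b. near k G b" if k: "k \<in> odd_layers m" for k
    unfolding near_def
    by (rule damped_string.modes_dense[OF layer_string[OF k] U(1,2)[OF k] g[OF k] U(4)[OF k] e])
  then obtain G \<beta> where near: "\<And>k. k \<in> odd_layers m \<Longrightarrow> near k (G k) (\<beta> k)" by metis
  note near = near[unfolded near_def]
  define F where "F = Sigma (odd_layers m) (\<lambda>k. G k)"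
  define b where "b i = \<beta> (fst i) (snd i)" for i
  have F: "finite F" "F \<subseteq> odd_layers m \<times> UNIV"
    unfolding F_def using near finite_odd_layers by (auto intro!: finite_SigmaI)
  have vi: "Pair k -` F = G k" if "k \<in> odd_layers m" for k using that by (auto simp: F_def)
  define S where "S = (\<Sum>i\<in>F. state_scale (b i) (case i of (k, n) \<Rightarrow> eigenstate L \<rho> E \<gamma> k n))"
  have bk: "(\<lambda>n. b (k, n)) = \<beta> k" for k by (simp add: b_def)
  have S: "fst (z - S) k = (\<lambda>x. u k x - layer_u k (G k) (\<beta> k) x)"
    "snd (z - S) k = (\<lambda>x. v k x - layer_v k (G k) (\<beta> k) x)" if k: "k \<in> odd_layers m" for k
    using eigenstate_sum[OF F k, of b] unfolding S_def[symmetric] vi[OF k] bk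
    by (auto simp: uv fun_eq_iff)
  have N: "(ip_norm (state_inner m L) (z - S))\<^sup>2 = (\<Sum>k\<in>odd_layers m. L2_sq L (fst (z - S) k)
      + L2_sq L (\<lambda>x. g k x - layer_cos k (G k) (\<beta> k) x) + L2_sq L (snd (z - S) k))"
  proof (rule state_norm_squared)
    fix k assume k: "k \<in> odd_layers m"
    interpret damped_string L "speed k" "\<gamma> k * speed k" "decay k" "shift k" by (rule layer_string[OF k])
    show "continuous_on {0..L} (fst (z - S) k)"
      unfolding S[OF k] by (intro continuous_intros U(1)[OF k] continuous_on_modes)
    have "has_weak_derivative L (\<lambda>x. u k x + (-1) * modes_u (G k) (\<beta> k) x)
        (\<lambda>x. g k x + (-1) * modes_cos (G k) (\<beta> k) x)"
      using near[OF k] by (intro weak_derivative_add weak_derivative_scale weak_derivative_modes g k) auto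
    then show "has_weak_derivative L (fst (z - S) k) (\<lambda>x. g k x - modes_cos (G k) (\<beta> k) x)"
      unfolding S[OF k] by simp
  qed
  have "(ip_norm (state_inner m L) (z - S))\<^sup>2 < (\<Sum>k\<in>odd_layers m. e)"
    unfolding N
  proof (rule sum_strict_mono[OF finite_odd_layers odd_layers_nonempty])
    fix k assume k: "k \<in> odd_layers m"
    show "L2_sq L (fst (z - S) k) + L2_sq L (\<lambda>x. g k x - layer_cos k (G k) (\<beta> k) x) + L2_sq L (snd (z - S) k) < e"
      unfolding S[OF k] using near[OF k] by (rule conjunct2)
  qed
  then have "(ip_norm (state_inner m L) (z - S))\<^sup>2 < \<epsilon>\<^sup>2"
    using card by (simp add: e_def)
  then have "ip_norm (state_inner m L) (z - S) < \<epsilon>"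
    using less_imp_le[OF \<open>0 < \<epsilon>\<close>] by (rule power2_less_imp_less)
  then show ?thesis using F unfolding S_def by (intro exI[of _ F] exI[of _ b] conjI)
qed

abbreviation "layer_low k \<equiv> damped_string.low L (speed k) (decay k)"
abbreviation "layer_high k \<equiv> damped_string.high L (speed k) (decay k)"

lemma eigenstates_norm_equivalence:
  "\<exists>A B. 0 < A \<and> 0 < B \<and> (\<forall>F c. finite F \<and> F \<subseteq> odd_layers m \<times> UNIV \<longrightarrow>
     A * (\<Sum>i\<in>F. (cmod (c i))\<^sup>2) \<le> (ip_norm (state_inner m L)
        (\<Sum>i\<in>F. state_scale (c i) (case i of (k, n) \<Rightarrow> eigenstate L \<rho> E \<gamma> k n)))\<^sup>2 \<and>
     (ip_norm (state_inner m L)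
        (\<Sum>i\<in>F. state_scale (c i) (case i of (k, n) \<Rightarrow> eigenstate L \<rho> E \<gamma> k n)))\<^sup>2
        \<le> B * (\<Sum>i\<in>F. (cmod (c i))\<^sup>2))"
proof (intro exI conjI allI impI)
  let ?O = "odd_layers m"
  let ?A = "Min (layer_low ` ?O)" and ?B = "Max (layer_high ` ?O)"
  note fin = finite_odd_layers[of m] and ne = odd_layers_nonempty[of m]
  have p: "0 < layer_low k" "0 < layer_high k" if "k \<in> ?O" for k
    using damped_string.low_high_pos[OF layer_string[OF that]] by auto
  show "0 < ?A" using p fin ne by simp
  obtain k0 where "k0 \<in> ?O" using ne by auto
  then show "0 < ?B" using p fin ne by (auto simp: Max_gr_iff)
  fix F :: "(nat \<times> int) set" and b :: "nat \<times> int \<Rightarrow> complex"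
  assume F': "finite F \<and> F \<subseteq> ?O \<times> UNIV"
  then have F: "finite F" "F \<subseteq> ?O \<times> UNIV" by auto
  define S where "S = (\<Sum>i\<in>F. state_scale (b i) (case i of (k, n) \<Rightarrow> eigenstate L \<rho> E \<gamma> k n))"
  define G where "G k = Pair k -` F" for k
  define s where "s k = (\<Sum>n\<in>G k. (cmod (b (k, n)))\<^sup>2)" for k
  define M where "M k = L2_sq L (layer_u k (G k) (\<lambda>n. b (k, n))) + L2_sq L (layer_cos k (G k) (\<lambda>n. b (k, n)))
      + L2_sq L (layer_v k (G k) (\<lambda>n. b (k, n)))" for k
  have G: "finite (G k)" for k unfolding G_def using F(1) by (intro finite_vimageI) (auto simp: inj_on_def)
  have comp: "fst S k = layer_u k (G k) (\<lambda>n. b (k, n))" "snd S k = layer_v k (G k) (\<lambda>n. b (k, n))"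
    if "k \<in> ?O" for k
    using eigenstate_sum[OF F that, of b] unfolding S_def G_def by auto
  have "(ip_norm (state_inner m L) S)\<^sup>2 = (\<Sum>k\<in>?O. L2_sq L (fst S k)
      + L2_sq L (layer_cos k (G k) (\<lambda>n. b (k, n))) + L2_sq L (snd S k))"
    by (rule state_norm_squared)
      (simp_all add: comp damped_string.continuous_on_modes[OF layer_string] damped_string.weak_derivative_modes[OF layer_string G])
  also have "\<dots> = (\<Sum>k\<in>?O. M k)" by (intro sum.cong refl) (simp add: comp M_def)
  finally have N: "(ip_norm (state_inner m L) S)\<^sup>2 = (\<Sum>k\<in>?O. M k)" .
  have s: "(\<Sum>i\<in>F. (cmod (b i))\<^sup>2) = (\<Sum>k\<in>?O. s k)"
    unfolding s_def G_def by (rule sum_layers[OF F])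
  have s0: "0 \<le> s k" for k by (simp add: s_def sum_nonneg)
  have "?A * s k \<le> M k" if k: "k \<in> ?O" for k
  proof -
    have "?A * s k \<le> layer_low k * s k" using k fin s0 by (intro mult_right_mono) auto
    also have "\<dots> \<le> M k"
      unfolding s_def M_def by (rule damped_string.modes_Riesz(1)[OF layer_string[OF k] G])
    finally show ?thesis .
  qed
  then show "?A * (\<Sum>i\<in>F. (cmod (b i))\<^sup>2) \<le> (ip_norm (state_inner m L)
      (\<Sum>i\<in>F. state_scale (b i) (case i of (k, n) \<Rightarrow> eigenstate L \<rho> E \<gamma> k n)))\<^sup>2"
    unfolding S_def[symmetric] N s sum_distrib_left by (rule sum_mono)
  have "M k \<le> ?B * s k" if k: "k \<in> ?O" for k
  proof -
    have "M k \<le> layer_high k * s k"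
      unfolding s_def M_def by (rule damped_string.modes_Riesz(2)[OF layer_string[OF k] G])
    also have "\<dots> \<le> ?B * s k" using k fin s0 by (intro mult_right_mono) auto
    finally show ?thesis .
  qed
  then show "(ip_norm (state_inner m L)
      (\<Sum>i\<in>F. state_scale (b i) (case i of (k, n) \<Rightarrow> eigenstate L \<rho> E \<gamma> k n)))\<^sup>2
      \<le> ?B * (\<Sum>i\<in>F. (cmod (b i))\<^sup>2)"
    unfolding S_def[symmetric] N s sum_distrib_left by (rule sum_mono)
qed

end

theorem theorem3p7:
  fixes m :: nat and L :: real and h \<rho> E \<gamma> :: "nat \<Rightarrow> real"
  assumes "m \<ge> 1" and "L > 0"
    and "\<And>k. k \<in> odd_layers m \<Longrightarrow> h k > 0 \<and> \<rho> k > 0 \<and> E k > 0 \<and> \<gamma> k > 0"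
    and "\<And>k. k \<in> odd_layers m \<Longrightarrow> \<gamma> k \<noteq> sqrt (\<rho> k / E k)"
  shows
    "{l. system_eigenvalue m L \<rho> E \<gamma> l} = {lam L \<rho> E \<gamma> k n | k n. k \<in> odd_layers m}
     \<and> (\<forall>k\<in>odd_layers m. \<forall>n.
          system_eigenfunction m L \<rho> E \<gamma> (lam L \<rho> E \<gamma> k n) (eigenstate L \<rho> E \<gamma> k n))
     \<and> (\<forall>l z. system_eigenfunction m L \<rho> E \<gamma> l z \<longrightarrow>
          (\<exists>F c. finite F \<and> F \<subseteq> {(k, n). k \<in> odd_layers m \<and> lam L \<rho> E \<gamma> k n = l} \<and>
             state_eq m L z (\<Sum>(k, n)\<in>F. state_scale (c (k, n)) (eigenstate L \<rho> E \<gamma> k n))))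
     \<and> riesz_basis state_scale (state_inner m L) (state_space m L)
          (odd_layers m \<times> UNIV) (\<lambda>(k, n). eigenstate L \<rho> E \<gamma> k n)"
proof (intro conjI ballI allI impI)
  interpret layered_system m L \<rho> E \<gamma>
    by unfold_locales (use assms in auto)
  show "{l. system_eigenvalue m L \<rho> E \<gamma> l} = {lam L \<rho> E \<gamma> k n | k n. k \<in> odd_layers m}"
    by (rule eigenvalues)
  show "system_eigenfunction m L \<rho> E \<gamma> (lam L \<rho> E \<gamma> k n) (eigenstate L \<rho> E \<gamma> k n)"
    if "k \<in> odd_layers m" for k n
    using that by (rule eigenstate_eigenfunction)
  show "\<exists>F c. finite F \<and> F \<subseteq> {(k, n). k \<in> odd_layers m \<and> lam L \<rho> E \<gamma> k n = l} \<and>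
      state_eq m L z (\<Sum>(k, n)\<in>F. state_scale (c (k, n)) (eigenstate L \<rho> E \<gamma> k n))"
    if "system_eigenfunction m L \<rho> E \<gamma> l z" for l z
  proof -
    have "(\<lambda>(k, n). state_scale (c (k, n)) (eigenstate L \<rho> E \<gamma> k n))
        = (\<lambda>i. state_scale (c i) (case i of (k, n) \<Rightarrow> eigenstate L \<rho> E \<gamma> k n))" for c
      by auto
    then show ?thesis using eigenfunction_span[OF that] by (simp only:)
  qed
  show "riesz_basis state_scale (state_inner m L) (state_space m L)
      (odd_layers m \<times> UNIV) (\<lambda>(k, n). eigenstate L \<rho> E \<gamma> k n)"
    unfolding riesz_basis_def
  proof (intro conjI ballI allI impI)
    fix i assume "i \<in> odd_layers m \<times> (UNIV :: int set)"
    then show "(case i of (k, n) \<Rightarrow> eigenstate L \<rho> E \<gamma> k n) \<in> state_space m L"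
      using eigenstate_in_space by (cases i) simp
  next
    fix z :: state and \<epsilon> :: real assume "z \<in> state_space m L" "0 < \<epsilon>"
    then show "\<exists>F c. finite F \<and> F \<subseteq> odd_layers m \<times> UNIV \<and> ip_norm (state_inner m L)
        (z - (\<Sum>i\<in>F. state_scale (c i) (case i of (k, n) \<Rightarrow> eigenstate L \<rho> E \<gamma> k n))) < \<epsilon>"
      by (rule eigenstates_dense)
  qed (rule eigenstates_norm_equivalence)
qed

end
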